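(* Let $\{X_n\}_{n\in\mathbb{N}}$ be a sequence of finite connected vertex-transitive graphs with uniformly bounded degree and $|X_n|\to\infty$, and let $X$ be their coarse disjoint union. Then $\{X_n\}_{n\in\mathbb{N}}$ is a sequence of expanders if and only if the averaging projection $P_X$ belongs to the uniform Roe algebra $C^*_u(X)$.
   Context: Graphs are undirected, without loops or multiple edges, identified with their vertex sets and equipped with the path metric. A graph is vertex-transitive if its automorphism group acts transitively on vertices. For $A\subseteq X_n$, $\partial A$ is the set of vertices outside $A$ adjacent to a vertex of $A$. A sequence $\{X_n\}$ of finite graphs with uniformly bounded degrees and $|X_n|\to\infty$ is a sequence of expanders if there is $c>0$ such that for every $n$ and every non-empty $A\subseteq X_n$ with $|A|\le\frac12|X_n|$ we have $|\partial A|>c|A|$. A coarse disjoint union of finite metric spaces $\{(X_n,d_n)\}$ is the set $X=\bigsqcup_n X_n$ with a metric $d$ that restricts to $d_n$ on each $X_n$ and satisfies $d(X_n,X_m)\ge n+m+\mathrm{diam}(X_n)+\mathrm{diam}(X_m)$ for $n\ne m$. View operators $T$ on $\ell^2(X)$ as matrices $[T_{x,y}]_{x,y\in X}$; $T$ has finite propagation if there is $R>0$ with $T_{x,y}=0$ whenever $d(x,y)>R$. The uniform Roe algebra $C^*_u(X)$ is the operator-norm closure of the $*$-algebra of bounded finite propagation operators on $\ell^2(X)$. The averaging projection is $P_X=\bigoplus_nP_{X_n}$ on $\ell^2(X)=\bigoplus_n\ell^2(X_n)$, where $P_{X_n}$ is the orthogonal projection of $\ell^2(X_n)$ onto the constant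 functions. *)

theory Defs
  imports
    "HOL-Analysis.Analysis"
    "Graph_Theory.Digraph_Component"
    "Graph_Theory.Pair_Digraph"
begin

section \<open>Graphs\<close>

text \<open>
  Finite simple graphs are the symmetric loopfree finite digraphs \<^locale>\<open>pair_graph\<close>:
  an undirected edge is a pair of opposite arcs, so the degree of a vertex is its out-degree.
  The name \<open>connected\<close> is taken by both topology and graph theory; the graph-theoretic
  notion (which includes that the graph has a vertex) gets its own name here.
\<close>

abbreviation graph_connected :: "'a pair_pre_digraph \<Rightarrow> bool" where
  "graph_connected G \<equiv> Digraph_Component.connected (with_proj G)"

definition graph_automorphism :: "'a pair_pre_digraph \<Rightarrow> ('a \<Rightarrow> 'a) \<Rightarrow> bool" where
  "graph_automorphism G \<phi> \<longleftrightarrow>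
     bij_betw \<phi> (pverts G) (pverts G) \<and>
     (\<forall>u\<in>pverts G. \<forall>v\<in>pverts G. (\<phi> u, \<phi> v) \<in> parcs G \<longleftrightarrow> (u, v) \<in> parcs G)"

definition vertex_transitive :: "'a pair_pre_digraph \<Rightarrow> bool" where
  "vertex_transitive G \<longleftrightarrow>
     (\<forall>u\<in>pverts G. \<forall>v\<in>pverts G. \<exists>\<phi>. graph_automorphism G \<phi> \<and> \<phi> u = v)"

text \<open>The path metric: \<open>(u, v) \<in> parcs G ^^ k\<close> says that there is a walk with \<open>k\<close> edges
  from \<open>u\<close> to \<open>v\<close>.  Only meaningful for vertices in the same connected component.\<close>

definition path_dist :: "'a pair_pre_digraph \<Rightarrow> 'a \<Rightarrow> 'a \<Rightarrow> real" where
  "path_dist G u v = real (LEAST k. (u, v) \<in> parcs G ^^ k)"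

definition vertex_boundary :: "'a pair_pre_digraph \<Rightarrow> 'a set \<Rightarrow> 'a set" where
  "vertex_boundary G A = {v \<in> pverts G - A. \<exists>u\<in>A. (u, v) \<in> parcs G}"

definition uniformly_bounded_degree :: "(nat \<Rightarrow> 'a pair_pre_digraph) \<Rightarrow> bool" where
  "uniformly_bounded_degree G \<longleftrightarrow>
     (\<exists>D. \<forall>n. \<forall>v\<in>pverts (G n). out_degree (with_proj (G n)) v \<le> D)"

definition expander_sequence :: "(nat \<Rightarrow> 'a pair_pre_digraph) \<Rightarrow> bool" where
  "expander_sequence G \<longleftrightarrow>
     (\<forall>n. pair_graph (G n)) \<and>
     uniformly_bounded_degree G \<and>
     filterlim (\<lambda>n. card (pverts (G n))) at_top sequentially \<and>
     (\<exists>c>0. \<forall>n A. A \<subseteq> pverts (G n) \<longrightarrow> A \<noteq> {} \<longrightarrow>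
        real (card A) \<le> 1/2 * real (card (pverts (G n))) \<longrightarrow>
        real (card (vertex_boundary (G n) A)) > c * real (card A))"


section \<open>Coarse disjoint unions\<close>

definition finite_diameter :: "'a set \<Rightarrow> ('a \<Rightarrow> 'a \<Rightarrow> real) \<Rightarrow> real" where
  "finite_diameter S d = Max ((\<lambda>(x, y). d x y) ` (S \<times> S))"

definition piece :: "(nat \<Rightarrow> 'a set) \<Rightarrow> nat \<Rightarrow> (nat \<times> 'a) set" where
  "piece S n = {n} \<times> S n"

definition disjoint_union :: "(nat \<Rightarrow> 'a set) \<Rightarrow> (nat \<times> 'a) set" where
  "disjoint_union S = (\<Union>n. piece S n)"

definition coarse_disjoint_union_metric ::
  "(nat \<Rightarrow> 'a set) \<Rightarrow> (nat \<Rightarrow> 'a \<Rightarrow> 'a \<Rightarrow> real) \<Rightarrow>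
   (nat \<times> 'a \<Rightarrow> nat \<times> 'a \<Rightarrow> real) \<Rightarrow> bool" where
  "coarse_disjoint_union_metric S ds d \<longleftrightarrow>
     Metric_space (disjoint_union S) d \<and>
     (\<forall>n. \<forall>x\<in>S n. \<forall>y\<in>S n. d (n, x) (n, y) = ds n x y) \<and>
     (\<forall>n m. n \<noteq> m \<longrightarrow> (\<forall>x\<in>S n. \<forall>y\<in>S m.
        d (n, x) (m, y) \<ge>
          real n + real m + finite_diameter (S n) (ds n) + finite_diameter (S m) (ds m)))"


section \<open>The Hilbert space of square-summable functions\<close>

typedef 'a ell2 = "{f :: 'a \<Rightarrow> complex. (\<lambda>x. (cmod (f x))\<^sup>2) summable_on UNIV}"
  morphisms ell2_apply Abs_ell2
  by (rule exI[of _ "\<lambda>_. 0"]) simp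

setup_lifting type_definition_ell2

lemma ell2_eqI: "(\<And>x. ell2_apply f x = ell2_apply g x) \<Longrightarrow> f = g"
  by (metis ell2_apply_inject ext)

lemma ell2_summable: "(\<lambda>x. (cmod (ell2_apply f x))\<^sup>2) summable_on A"
  by (rule summable_on_subset_banach[of _ UNIV]) (use ell2_apply[of f] in simp_all)

lemma two_mult_le_sum_squares: "2 * (a * b) \<le> a\<^sup>2 + b\<^sup>2" for a b :: real
  using sum_squares_bound[of a b] by (simp add: mult.assoc)

lemma ell2_product_abs_summable:
  assumes "(\<lambda>x. (cmod (f x))\<^sup>2) summable_on A" "(\<lambda>x. (cmod (g x))\<^sup>2) summable_on A"
  shows "(\<lambda>x. norm (cnj (f x) * g x)) summable_on A"
proof (rule Infinite_Sum.abs_summable_on_comparison_test)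
  have "(\<lambda>x. (cmod (f x))\<^sup>2 + (cmod (g x))\<^sup>2) summable_on A"
    using assms by (rule summable_on_add)
  then show "(\<lambda>x. norm ((cmod (f x))\<^sup>2 + (cmod (g x))\<^sup>2)) summable_on A"
    by simp
  fix x
  have "0 \<le> cmod (f x) * cmod (g x)" by simp
  with two_mult_le_sum_squares[of "cmod (f x)" "cmod (g x)"]
  show "norm (cnj (f x) * g x) \<le> norm ((cmod (f x))\<^sup>2 + (cmod (g x))\<^sup>2)"
    unfolding norm_mult complex_mod_cnj real_norm_def by linarith
qed

lemma ell2_add_summable:
  fixes f g :: "'a \<Rightarrow> complex"
  assumes "(\<lambda>x. (cmod (f x))\<^sup>2) summable_on A" "(\<lambda>x. (cmod (g x))\<^sup>2) summable_on A"
  shows "(\<lambda>x. (cmod (f x + g x))\<^sup>2) summable_on A"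
proof (rule summable_on_comparison_test)
  show "(\<lambda>x. 2 * (cmod (f x))\<^sup>2 + 2 * (cmod (g x))\<^sup>2) summable_on A"
    using assms by (intro summable_on_add summable_on_cmult_right)
  fix x
  have "(cmod (f x + g x))\<^sup>2 \<le> (cmod (f x) + cmod (g x))\<^sup>2"
    by (intro power_mono norm_triangle_ineq) simp
  with two_mult_le_sum_squares[of "cmod (f x)" "cmod (g x)"]
  show "(cmod (f x + g x))\<^sup>2 \<le> 2 * (cmod (f x))\<^sup>2 + 2 * (cmod (g x))\<^sup>2"
    by (simp add: power2_sum)
qed auto

lift_definition scaleC_ell2 :: "complex \<Rightarrow> 'a ell2 \<Rightarrow> 'a ell2" (infixr \<open>*\<^sub>C\<close> 75)
  is "\<lambda>c f x. c * f x"
  by (simp add: norm_mult power_mult_distrib summable_on_cmult_right)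

instantiation ell2 :: (type) real_vector
begin

lift_definition zero_ell2 :: "'a ell2" is "\<lambda>_. 0" by simp
lift_definition plus_ell2 :: "'a ell2 \<Rightarrow> 'a ell2 \<Rightarrow> 'a ell2" is "\<lambda>f g x. f x + g x"
  by (rule ell2_add_summable)
lift_definition uminus_ell2 :: "'a ell2 \<Rightarrow> 'a ell2" is "\<lambda>f x. - f x" by simp
lift_definition minus_ell2 :: "'a ell2 \<Rightarrow> 'a ell2 \<Rightarrow> 'a ell2" is "\<lambda>f g x. f x - g x"
proof -
  fix f g :: "'a \<Rightarrow> complex"
  assume "(\<lambda>x. (cmod (f x))\<^sup>2) summable_on UNIV" "(\<lambda>x. (cmod (g x))\<^sup>2) summable_on UNIV"
  then show "(\<lambda>x. (cmod (f x - g x))\<^sup>2) summable_on UNIV"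
    using ell2_add_summable[of f UNIV "\<lambda>x. - g x"] by simp
qed
lift_definition scaleR_ell2 :: "real \<Rightarrow> 'a ell2 \<Rightarrow> 'a ell2" is "\<lambda>r f x. of_real r * f x"
  by (simp add: norm_mult power_mult_distrib summable_on_cmult_right)

instance
proof
  fix x y z :: "'a ell2" and a b :: real
  show "x + y + z = x + (y + z)" by (rule ell2_eqI) (simp add: plus_ell2.rep_eq)
  show "x + y = y + x" by (rule ell2_eqI) (simp add: plus_ell2.rep_eq)
  show "0 + x = x" by (rule ell2_eqI) (simp add: plus_ell2.rep_eq zero_ell2.rep_eq)
  show "- x + x = 0"
    by (rule ell2_eqI) (simp add: plus_ell2.rep_eq zero_ell2.rep_eq uminus_ell2.rep_eq)
  show "x - y = x + - y"
    by (rule ell2_eqI) (simp add: plus_ell2.rep_eq minus_ell2.rep_eq uminus_ell2.rep_eq)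
  show "a *\<^sub>R (x + y) = a *\<^sub>R x + a *\<^sub>R y" "(a + b) *\<^sub>R x = a *\<^sub>R x + b *\<^sub>R x"
    by (rule ell2_eqI, simp add: plus_ell2.rep_eq scaleR_ell2.rep_eq distrib_left distrib_right)+
  show "a *\<^sub>R b *\<^sub>R x = (a * b) *\<^sub>R x" "1 *\<^sub>R x = x"
    by (rule ell2_eqI, simp add: scaleR_ell2.rep_eq)+
qed

end

lemmas ell2_apply_simps [simp] =
  zero_ell2.rep_eq plus_ell2.rep_eq uminus_ell2.rep_eq minus_ell2.rep_eq
  scaleR_ell2.rep_eq scaleC_ell2.rep_eq

definition cinner :: "'a ell2 \<Rightarrow> 'a ell2 \<Rightarrow> complex" where
  "cinner f g = (\<Sum>\<^sub>\<infinity>x. cnj (ell2_apply f x) * ell2_apply g x)"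

lemma cinner_summable: "(\<lambda>x. cnj (ell2_apply f x) * ell2_apply g x) summable_on A"
  by (rule abs_summable_summable[OF ell2_product_abs_summable[OF ell2_summable ell2_summable]])

lemma cinner_add_left: "cinner (f + g) h = cinner f h + cinner g h"
  by (simp add: cinner_def distrib_right infsum_add[OF cinner_summable cinner_summable])

lemma cinner_scaleC_left: "cinner (c *\<^sub>C f) g = cnj c * cinner f g"
  unfolding cinner_def scaleC_ell2.rep_eq complex_cnj_mult mult.assoc
  by (rule infsum_cmult_right[OF cinner_summable])

lemma cinner_commute: "cinner g f = cnj (cinner f g)"
  unfolding cinner_def infsum_cnj[symmetric] by (rule infsum_cong) simp

lemma cinner_self: "cinner f f = of_real (\<Sum>\<^sub>\<infinity>x. (cmod (ell2_apply f x))\<^sup>2)"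
proof -
  have "cinner f f = (\<Sum>\<^sub>\<infinity>x. of_real ((cmod (ell2_apply f x))\<^sup>2))"
    unfolding cinner_def complex_norm_square by (rule infsum_cong) simp
  also have "\<dots> = of_real (\<Sum>\<^sub>\<infinity>x. (cmod (ell2_apply f x))\<^sup>2)"
    by (intro infsumI has_sum_of_real has_sum_infsum ell2_summable)
  finally show ?thesis .
qed

instantiation ell2 :: (type) real_inner
begin

definition inner_ell2 :: "'a ell2 \<Rightarrow> 'a ell2 \<Rightarrow> real" where
  "inner_ell2 f g = Re (cinner f g)"
definition norm_ell2 :: "'a ell2 \<Rightarrow> real" where
  "norm_ell2 f = sqrt (\<Sum>\<^sub>\<infinity>x. (cmod (ell2_apply f x))\<^sup>2)"
definition sgn_ell2 :: "'a ell2 \<Rightarrow> 'a ell2" where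
  "sgn_ell2 f = f /\<^sub>R norm f"
definition dist_ell2 :: "'a ell2 \<Rightarrow> 'a ell2 \<Rightarrow> real" where
  "dist_ell2 f g = norm (f - g)"
definition uniformity_ell2 :: "('a ell2 \<times> 'a ell2) filter" where
  "uniformity_ell2 = (INF e\<in>{0<..}. principal {(x, y). dist x y < e})"
definition open_ell2 :: "'a ell2 set \<Rightarrow> bool" where
  "open_ell2 U = (\<forall>x\<in>U. \<forall>\<^sub>F (x', y) in uniformity. x' = x \<longrightarrow> y \<in> U)"

instance
proof
  fix f g h :: "'a ell2" and r :: real
  show "inner f g = inner g f"
    unfolding inner_ell2_def by (subst cinner_commute) simp
  show "inner (f + g) h = inner f h + inner g h"
    by (simp add: inner_ell2_def cinner_add_left)
  have "r *\<^sub>R f = complex_of_real r *\<^sub>C f"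
    by (rule ell2_eqI) simp
  then show "inner (r *\<^sub>R f) g = r * inner f g"
    by (simp add: inner_ell2_def cinner_scaleC_left)
  show "0 \<le> inner f f"
    by (simp add: inner_ell2_def cinner_self infsum_nonneg)
  show "inner f f = 0 \<longleftrightarrow> f = 0"
  proof
    assume "inner f f = 0"
    then have *: "(\<Sum>\<^sub>\<infinity>x. (cmod (ell2_apply f x))\<^sup>2) = 0"
      by (simp add: inner_ell2_def cinner_self)
    have "(cmod (ell2_apply f x))\<^sup>2 = 0" for x
      by (rule nonneg_infsum_le_0D[where f = "\<lambda>x. (cmod (ell2_apply f x))\<^sup>2" and A = UNIV])
        (simp_all add: * ell2_summable)
    then show "f = 0"
      by (intro ell2_eqI) simp
  qed (simp add: inner_ell2_def cinner_def)
  show "norm f = sqrt (inner f f)"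
    by (simp add: norm_ell2_def inner_ell2_def cinner_self)
  show "dist f g = norm (f - g)" by (rule dist_ell2_def)
  show "sgn f = f /\<^sub>R norm f" by (rule sgn_ell2_def)
  show "(uniformity :: ('a ell2 \<times> _) filter) = (INF e\<in>{0<..}. principal {(x, y). dist x y < e})"
    by (rule uniformity_ell2_def)
  show "open U = (\<forall>x\<in>U. \<forall>\<^sub>F (x', y) in uniformity. x' = x \<longrightarrow> y \<in> U)" for U :: "'a ell2 set"
    by (rule open_ell2_def)
qed

end

lift_definition ket :: "'a \<Rightarrow> 'a ell2" is "\<lambda>y x. if x = y then 1 else 0"
proof -
  fix y :: 'a
  let ?f = "\<lambda>x. (cmod (if x = y then 1 else 0))\<^sup>2"
  have "?f summable_on {y}"
    by simp
  also have "?f summable_on {y} \<longleftrightarrow> ?f summable_on UNIV"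
    by (rule summable_on_cong_neutral) auto
  finally show "?f summable_on UNIV" .
qed

lift_definition ell2_restrict :: "'a set \<Rightarrow> 'a ell2 \<Rightarrow> 'a ell2"
  is "\<lambda>A f x. if x \<in> A then f x else 0"
proof -
  fix A and f :: "'a \<Rightarrow> complex"
  assume "(\<lambda>x. (cmod (f x))\<^sup>2) summable_on UNIV"
  then show "(\<lambda>x. (cmod (if x \<in> A then f x else 0))\<^sup>2) summable_on UNIV"
    by (rule summable_on_comparison_test) auto
qed

text \<open>For a subset \<open>X\<close> of the ground type, the Hilbert space \<open>\<ell>\<^sup>2(X)\<close> is identified with the
  closed subspace of functions vanishing off \<open>X\<close>.\<close>

definition ell2_on :: "'a set \<Rightarrow> 'a ell2 set" where
  "ell2_on X = {f. \<forall>x. x \<notin> X \<longrightarrow> ell2_apply f x = 0}"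


section \<open>The uniform Roe algebra\<close>

text \<open>
  A bounded operator on \<open>\<ell>\<^sup>2(X)\<close> is identified with its extension by zero on the orthogonal
  complement of \<open>\<ell>\<^sup>2(X)\<close>; this does not change the operator norm, which is the norm of the type
  \<^typ>\<open>'a ell2 \<Rightarrow>\<^sub>L 'a ell2\<close>.  Elements of that type are only real-linear a priori, so
  complex homogeneity has to be required.
\<close>

definition operators_on :: "'a set \<Rightarrow> ('a ell2 \<Rightarrow>\<^sub>L 'a ell2) set" where
  "operators_on X = {T.
     (\<forall>c f. blinfun_apply T (c *\<^sub>C f) = c *\<^sub>C blinfun_apply T f) \<and>
     (\<forall>f. blinfun_apply T f \<in> ell2_on X) \<and>
     (\<forall>f. blinfun_apply T (ell2_restrict X f) = blinfun_apply T f)}"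

definition matrix_entry :: "('a ell2 \<Rightarrow>\<^sub>L 'a ell2) \<Rightarrow> 'a \<Rightarrow> 'a \<Rightarrow> complex" where
  "matrix_entry T x y = ell2_apply (blinfun_apply T (ket y)) x"

definition finite_propagation ::
  "'a set \<Rightarrow> ('a \<Rightarrow> 'a \<Rightarrow> real) \<Rightarrow> ('a ell2 \<Rightarrow>\<^sub>L 'a ell2) \<Rightarrow> bool" where
  "finite_propagation X d T \<longleftrightarrow>
     (\<exists>R>0. \<forall>x\<in>X. \<forall>y\<in>X. d x y > R \<longrightarrow> matrix_entry T x y = 0)"

definition uniform_roe_algebra ::
  "'a set \<Rightarrow> ('a \<Rightarrow> 'a \<Rightarrow> real) \<Rightarrow> ('a ell2 \<Rightarrow>\<^sub>L 'a ell2) set" where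
  "uniform_roe_algebra X d = closure {T \<in> operators_on X. finite_propagation X d T}"


section \<open>The averaging projection\<close>

definition orthogonal_projection :: "'a ell2 set \<Rightarrow> 'a ell2 \<Rightarrow> 'a ell2" where
  "orthogonal_projection S f = (THE g. g \<in> S \<and> (\<forall>h\<in>S. cinner h (f - g) = 0))"

definition constant_functions :: "'a set \<Rightarrow> 'a ell2 set" where
  "constant_functions A = {f \<in> ell2_on A. \<exists>c. \<forall>x\<in>A. ell2_apply f x = c}"

text \<open>The direct sum \<open>\<Oplus>\<^sub>n T n\<close> of operators \<open>T n\<close> on \<open>\<ell>\<^sup>2(A n)\<close>, for disjoint sets \<open>A n\<close>.\<close>

definition direct_sum_operator ::
  "(nat \<Rightarrow> 'a set) \<Rightarrow> (nat \<Rightarrow> 'a ell2 \<Rightarrow> 'a ell2) \<Rightarrow> ('a ell2 \<Rightarrow>\<^sub>L 'a ell2)" where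
  "direct_sum_operator A T = (THE P. \<forall>f.
     blinfun_apply P f \<in> ell2_on (\<Union>n. A n) \<and>
     (\<forall>n. ell2_restrict (A n) (blinfun_apply P f) = T n (ell2_restrict (A n) f)))"

definition averaging_projection :: "(nat \<Rightarrow> 'a set) \<Rightarrow> ('a ell2 \<Rightarrow>\<^sub>L 'a ell2)" where
  "averaging_projection A =
     direct_sum_operator A (\<lambda>n. orthogonal_projection (constant_functions (A n)))"

text \<open>The definite descriptions above are proper for disjoint finite sets \<open>A n\<close>, where the
  projection replaces \<open>f\<close> on each \<open>A n\<close> by its average over \<open>A n\<close>.\<close>

lemma ell2_apply_sum_ket:
  "finite A \<Longrightarrow> ell2_apply (\<Sum>y\<in>A. ket y) x = (if x \<in> A then 1 else 0)"
  by (induction A rule: finite_induct) (auto simp: ket.rep_eq)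

lemma cinner_finite_support:
  assumes "finite A" "h \<in> ell2_on A"
  shows "cinner h g = (\<Sum>x\<in>A. cnj (ell2_apply h x) * ell2_apply g x)"
proof -
  have "cinner h g = (\<Sum>\<^sub>\<infinity>x\<in>A. cnj (ell2_apply h x) * ell2_apply g x)"
    unfolding cinner_def using assms(2) by (intro infsum_cong_neutral) (auto simp: ell2_on_def)
  with assms(1) show ?thesis by simp
qed

lemma orthogonal_projection_constant_functions:
  assumes "finite A"
  shows "orthogonal_projection (constant_functions A) f =
    ((\<Sum>x\<in>A. ell2_apply f x) / of_nat (card A)) *\<^sub>C (\<Sum>y\<in>A. ket y)"
    (is "_ = ?avg *\<^sub>C ?ind")
  unfolding orthogonal_projection_def
proof (rule the_equality)
  note ind = ell2_apply_sum_ket[OF assms]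
  have const: "c *\<^sub>C ?ind \<in> constant_functions A" for c
    by (auto simp: constant_functions_def ell2_on_def ind)
  have "cinner h (f - ?avg *\<^sub>C ?ind) = 0" if "h \<in> constant_functions A" for h
  proof -
    from that obtain c where c: "\<And>x. x \<in> A \<Longrightarrow> ell2_apply h x = c" and "h \<in> ell2_on A"
      by (auto simp: constant_functions_def)
    then have "cinner h (f - ?avg *\<^sub>C ?ind) = (\<Sum>x\<in>A. cnj c * (ell2_apply f x - ?avg))"
      by (subst cinner_finite_support[OF assms]) (auto simp: ind intro!: sum.cong)
    also have "\<dots> = cnj c * ((\<Sum>x\<in>A. ell2_apply f x) - of_nat (card A) * ?avg)"
      by (simp add: sum_subtractf flip: sum_distrib_left)
    also have "\<dots> = 0"
      using assms by (cases "A = {}") simp_all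
    finally show ?thesis .
  qed
  with const show "?avg *\<^sub>C ?ind \<in> constant_functions A \<and>
      (\<forall>h\<in>constant_functions A. cinner h (f - ?avg *\<^sub>C ?ind) = 0)"
    by blast
  fix g
  assume g: "g \<in> constant_functions A \<and> (\<forall>h\<in>constant_functions A. cinner h (f - g) = 0)"
  then obtain c where c: "\<And>x. x \<in> A \<Longrightarrow> ell2_apply g x = c"
    and off: "\<And>x. x \<notin> A \<Longrightarrow> ell2_apply g x = 0"
    by (auto simp: constant_functions_def ell2_on_def)
  have one: "?ind \<in> constant_functions A"
    by (auto simp: constant_functions_def ell2_on_def ind)
  then have "0 = cinner ?ind (f - g)"
    using g by auto
  also have "\<dots> = (\<Sum>x\<in>A. ell2_apply f x - c)"
    using one
    by (subst cinner_finite_support[OF assms])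
      (auto simp: constant_functions_def ind c intro!: sum.cong)
  also have "\<dots> = (\<Sum>x\<in>A. ell2_apply f x) - of_nat (card A) * c"
    by (simp add: sum_subtractf)
  finally have "?avg = c" if "A \<noteq> {}"
    using that assms by (simp add: field_simps)
  then show "g = ?avg *\<^sub>C ?ind"
    by (intro ell2_eqI) (auto simp: ind c off)
qed

lemma averaging_projection_apply:
  assumes disj: "disjoint_family A" and fin: "\<And>n. finite (A n)"
  shows "x \<in> A n \<Longrightarrow> ell2_apply (blinfun_apply (averaging_projection A) f) x =
           (\<Sum>y\<in>A n. ell2_apply f y) / of_nat (card (A n))"
    and "x \<notin> (\<Union>n. A n) \<Longrightarrow> ell2_apply (blinfun_apply (averaging_projection A) f) x = 0"
proof -
  define avg where "avg f n = (\<Sum>y\<in>A n. ell2_apply f y) / of_nat (card (A n))" for f n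
  define idx where "idx x = (THE n. x \<in> A n)" for x
  define val where "val f x = (if x \<in> (\<Union>n. A n) then avg f (idx x) else 0)" for f x
  have idx: "idx x = n" if "x \<in> A n" for x n
    unfolding idx_def using that disj
    by (intro the_equality) (auto simp: disjoint_family_on_def)
  have val: "val f x = avg f n" if "x \<in> A n" for f x n
    using that idx[OF that] by (auto simp: val_def)
  have block: "(\<Sum>x\<in>A n. (cmod (val f x))\<^sup>2) \<le> (\<Sum>x\<in>A n. (cmod (ell2_apply f x))\<^sup>2)" for f n
  proof (cases "A n = {}")
    case False
    then have pos: "real (card (A n)) > 0"
      using fin by (simp add: card_gt_0_iff)
    have "(cmod (\<Sum>y\<in>A n. ell2_apply f y))\<^sup>2 \<le> (\<Sum>y\<in>A n. cmod (ell2_apply f y))\<^sup>2"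
      by (intro power_mono norm_sum) simp
    also have "\<dots> \<le> (\<Sum>y\<in>A n. (cmod (ell2_apply f y))\<^sup>2) * card (A n)"
      by (rule sum_squared_le_sum_of_squares)
    finally have "(cmod (\<Sum>y\<in>A n. ell2_apply f y))\<^sup>2 / card (A n)
        \<le> (\<Sum>y\<in>A n. (cmod (ell2_apply f y))\<^sup>2)"
      using pos by (simp add: divide_le_eq)
    moreover have "(\<Sum>x\<in>A n. (cmod (val f x))\<^sup>2) =
        (cmod (\<Sum>y\<in>A n. ell2_apply f y))\<^sup>2 / card (A n)"
      using pos by (simp add: val avg_def norm_divide power_divide power2_eq_square)
    ultimately show ?thesis by simp
  qed simp
  have partial: "(\<Sum>x\<in>F. (cmod (val f x))\<^sup>2) \<le> (norm f)\<^sup>2" if "finite F" for f F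
  proof -
    define N where "N = idx ` (F \<inter> (\<Union>n. A n))"
    have N: "finite N" using that by (simp add: N_def)
    have "F \<inter> (\<Union>n. A n) \<subseteq> (\<Union>n\<in>N. A n)"
      using idx by (force simp: N_def)
    moreover have "(\<Sum>x\<in>F. (cmod (val f x))\<^sup>2) = (\<Sum>x\<in>F \<inter> (\<Union>n. A n). (cmod (val f x))\<^sup>2)"
      using that by (intro sum.mono_neutral_right) (auto simp: val_def)
    ultimately have "(\<Sum>x\<in>F. (cmod (val f x))\<^sup>2) \<le> (\<Sum>x\<in>(\<Union>n\<in>N. A n). (cmod (val f x))\<^sup>2)"
      using N fin by (simp only:) (rule sum_mono2, auto)
    also have "\<dots> = (\<Sum>n\<in>N. \<Sum>x\<in>A n. (cmod (val f x))\<^sup>2)"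
      using N fin disj by (intro sum.UNION_disjoint) (auto simp: disjoint_family_on_def)
    also have "\<dots> \<le> (\<Sum>n\<in>N. \<Sum>x\<in>A n. (cmod (ell2_apply f x))\<^sup>2)"
      by (intro sum_mono block)
    also have "\<dots> = (\<Sum>x\<in>(\<Union>n\<in>N. A n). (cmod (ell2_apply f x))\<^sup>2)"
      using N fin disj
      by (intro sum.UNION_disjoint[symmetric]) (auto simp: disjoint_family_on_def)
    also have "\<dots> \<le> (\<Sum>\<^sub>\<infinity>x. (cmod (ell2_apply f x))\<^sup>2)"
      using N fin by (intro finite_sum_le_infsum ell2_summable) auto
    also have "\<dots> = (norm f)\<^sup>2"
      by (simp add: norm_ell2_def infsum_nonneg)
    finally show ?thesis .
  qed
  have summable: "(\<lambda>x. (cmod (val f x))\<^sup>2) summable_on UNIV" for f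
    by (rule nonneg_bdd_above_summable_on) (auto intro!: bdd_aboveI2 partial)
  define P where "P f = Abs_ell2 (val f)" for f
  have P: "ell2_apply (P f) x = val f x" for f x
    unfolding P_def using summable by (subst Abs_ell2_inverse) auto
  have "bounded_linear P"
  proof (rule bounded_linear_intro[where K = 1])
    show "P (f + g) = P f + P g" for f g
      by (intro ell2_eqI) (simp add: P val_def avg_def sum.distrib add_divide_distrib)
    show "P (r *\<^sub>R f) = r *\<^sub>R P f" for r f
      by (intro ell2_eqI) (simp add: P val_def avg_def flip: sum_distrib_left)
    show "norm (P f) \<le> norm f * 1" for f
    proof -
      have "(norm (P f))\<^sup>2 = (\<Sum>\<^sub>\<infinity>x. (cmod (val f x))\<^sup>2)"
        by (simp add: norm_ell2_def P infsum_nonneg)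
      also have "\<dots> \<le> (norm f)\<^sup>2"
        by (intro infsum_le_finite_sums summable partial)
      finally show ?thesis
        by (simp add: power2_le_iff_abs_le)
    qed
  qed
  then have Blinfun_P: "blinfun_apply (Blinfun P) = P"
    by (rule bounded_linear_Blinfun_apply)
  have orth: "ell2_apply (orthogonal_projection (constant_functions (A n))
      (ell2_restrict (A n) f)) x = (if x \<in> A n then avg f n else 0)" for n f x
    by (simp add: orthogonal_projection_constant_functions[OF fin] ell2_apply_sum_ket[OF fin]
        avg_def ell2_restrict.rep_eq)
  have "averaging_projection A = Blinfun P"
    unfolding averaging_projection_def direct_sum_operator_def
  proof (rule the_equality)
    show "\<forall>f. blinfun_apply (Blinfun P) f \<in> ell2_on (\<Union>n. A n) \<and>
        (\<forall>n. ell2_restrict (A n) (blinfun_apply (Blinfun P) f) =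
          orthogonal_projection (constant_functions (A n)) (ell2_restrict (A n) f))"
    proof (intro allI conjI)
      show "blinfun_apply (Blinfun P) f \<in> ell2_on (\<Union>n. A n)" for f
        by (simp add: Blinfun_P ell2_on_def P val_def)
      show "ell2_restrict (A n) (blinfun_apply (Blinfun P) f) =
          orthogonal_projection (constant_functions (A n)) (ell2_restrict (A n) f)" for f n
        by (rule ell2_eqI) (simp add: Blinfun_P orth ell2_restrict.rep_eq P val)
    qed
    fix Q
    assume Q: "\<forall>f. blinfun_apply Q f \<in> ell2_on (\<Union>n. A n) \<and>
        (\<forall>n. ell2_restrict (A n) (blinfun_apply Q f) =
          orthogonal_projection (constant_functions (A n)) (ell2_restrict (A n) f))"
    have "ell2_apply (blinfun_apply Q f) x = val f x" for f x
    proof (cases "x \<in> (\<Union>n. A n)")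
      case True
      then obtain n where n: "x \<in> A n" by blast
      then have "ell2_apply (blinfun_apply Q f) x =
          ell2_apply (ell2_restrict (A n) (blinfun_apply Q f)) x"
        by (simp add: ell2_restrict.rep_eq)
      also have "\<dots> = avg f n"
        using Q n by (simp add: orth)
      finally show ?thesis using val[OF n] by simp
    next
      case False
      then show ?thesis using Q by (auto simp: ell2_on_def val_def)
    qed
    then show "Q = Blinfun P"
      by (intro blinfun_eqI ell2_eqI) (simp add: Blinfun_P P)
  qed
  then have *: "ell2_apply (blinfun_apply (averaging_projection A) f) x = val f x" for f x
    by (simp add: Blinfun_P P)
  show "x \<in> A n \<Longrightarrow> ell2_apply (blinfun_apply (averaging_projection A) f) x =
      (\<Sum>y\<in>A n. ell2_apply f y) / of_nat (card (A n))"
    by (simp only: * val avg_def)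
  show "x \<notin> (\<Union>n. A n) \<Longrightarrow> ell2_apply (blinfun_apply (averaging_projection A) f) x = 0"
    by (simp only: * val_def if_False)
qed

end

theory Submission
  imports Defs
begin

text \<open>
  For expanders, the operator \<open>M = 1 - L / (2 D)\<close>, with \<open>L\<close> the graph Laplacian and \<open>D\<close> a degree
  bound, has propagation 1 and fixes the constant functions on each piece, and Cheeger's
  inequality makes it a strict contraction, uniformly in the piece, on functions of mean zero.
  Hence \<open>M\<^sup>k\<close> converges in norm to the averaging projection.

  Conversely, let \<open>T\<close> have propagation at most \<open>R\<close> and distance less than \<open>1/4\<close> from the averaging
  projection.  Comparing matrix coefficients between \<open>U \<subseteq> X\<^sub>n\<close> and the complement of its
  \<open>R\<close>-neighbourhood shows that this neighbourhood is substantially larger than \<open>U\<close> whenever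
  \<open>|X\<^sub>n| / 4 \<le> |U| \<le> |X\<^sub>n| / 2\<close>; so sets of this size expand.  A smaller set \<open>A\<close> has
  boundedly overlapping translates under the automorphism group whose union \<open>U\<close> has such a size,
  and \<open>|\<partial>U| / |U| \<le> 2 |\<partial>A| / |A|\<close>.
\<close>

section \<open>Spectral gap of a finite graph from edge expansion\<close>

section \<open>Cheeger's inequality\<close>

text \<open>Dividing the Laplacian by \<open>2 * D\<close> rather than by \<open>D\<close> makes the
  walk lazy. With degrees at most \<open>D\<close> the Laplacian has spectrum in [0, 2D], so no
  eigenvalue of the result lies below 0, and the bipartite eigenvalue -1 cannot spoil the
  convergence of powers.\<close>

definition smoothing :: "('a \<times> 'a) set \<Rightarrow> nat \<Rightarrow> ('a \<Rightarrow> complex) \<Rightarrow> 'a \<Rightarrow> complex" where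
  "smoothing E D f x = f x - (\<Sum>y\<in>E `` {x}. f x - f y) / of_nat (2 * D)"

text \<open>Each undirected edge appears in \<open>E\<close> with both orientations. Sums over
  \<open>E\<close> therefore count it twice, which accounts for the factors of 2 in the energy
  estimates.\<close>

locale bounded_degree_relation =
  fixes V :: "'a set" and E :: "('a \<times> 'a) set" and D :: nat
  assumes finite_V: "finite V" and E_subset: "E \<subseteq> V \<times> V" and sym_E: "sym E"
    and degree_le: "\<And>v. v \<in> V \<Longrightarrow> card (E `` {v}) \<le> D"
begin

lemma finite_E: "finite E"
  using finite_V E_subset by (meson finite_SigmaI finite_subset)

lemma finite_neighbours: "finite (E `` {v})"
  using finite_E by (simp add: finite_Image)

lemma neighbours_subset: "E `` {v} \<subseteq> V"
  using E_subset by blast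

lemma sum_E_iterated:
  fixes f :: "'a \<Rightarrow> 'a \<Rightarrow> 'b::comm_monoid_add"
  shows "(\<Sum>(x, y)\<in>E. f x y) = (\<Sum>x\<in>V. \<Sum>y\<in>E `` {x}. f x y)"
proof -
  have "E = Sigma V (\<lambda>x. E `` {x})" using E_subset by auto
  then have "(\<Sum>(x, y)\<in>E. f x y) = (\<Sum>(x, y)\<in>Sigma V (\<lambda>x. E `` {x}). f x y)" by simp
  also have "\<dots> = (\<Sum>x\<in>V. \<Sum>y\<in>E `` {x}. f x y)"
    using finite_V finite_neighbours by (subst sum.Sigma) auto
  finally show ?thesis .
qed

lemma sum_E_swap:
  fixes f :: "'a \<Rightarrow> 'a \<Rightarrow> 'b::comm_monoid_add"
  shows "(\<Sum>(x, y)\<in>E. f x y) = (\<Sum>(x, y)\<in>E. f y x)"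
  by (rule sum.reindex_bij_witness[where i = prod.swap and j = prod.swap])
    (use sym_E in \<open>auto dest: symD\<close>)

lemma sum_E_fst_le:
  fixes f :: "'a \<Rightarrow> real"
  assumes "\<And>x. f x \<ge> 0"
  shows "(\<Sum>(x, y)\<in>E. f x) \<le> real D * (\<Sum>x\<in>V. f x)"
proof -
  have "(\<Sum>(x, y)\<in>E. f x) = (\<Sum>x\<in>V. real (card (E `` {x})) * f x)"
    by (simp add: sum_E_iterated)
  also have "\<dots> \<le> (\<Sum>x\<in>V. real D * f x)"
    by (intro sum_mono mult_right_mono assms) (simp add: degree_le)
  finally show ?thesis by (simp add: sum_distrib_left)
qed

text \<open>Induction on the support, peeling off the lowest positive level of \<open>\<phi>\<close>.\<close>

lemma coarea_inequality:
  fixes \<phi> :: "'a \<Rightarrow> real"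
  assumes "\<And>x. \<phi> x \<ge> 0"
    and "\<And>A. A \<subseteq> {x \<in> V. \<phi> x > 0} \<Longrightarrow> c * real (card A) \<le> real (card (E \<inter> A \<times> (- A)))"
  shows "c * (\<Sum>x\<in>V. \<phi> x) \<le> (\<Sum>(x, y)\<in>E. max 0 (\<phi> x - \<phi> y))"
  using assms
proof (induction "card {x \<in> V. \<phi> x > 0}" arbitrary: \<phi> rule: less_induct)
  case less
  define S where "S = {x \<in> V. \<phi> x > 0}"
  have fin: "finite S" using finite_V by (simp add: S_def)
  show ?case
  proof (cases "S = {}")
    case True
    then have "\<phi> x = 0" if "x \<in> V" for x
      using less.prems(1)[of x] that by (force simp: S_def)
    then have "(\<Sum>x\<in>V. \<phi> x) = 0" by simp
    then show ?thesis by (simp add: sum_nonneg case_prod_beta)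
  next
    case False
    define m where "m = Min (\<phi> ` S)"
    have "m \<in> \<phi> ` S" unfolding m_def using fin False by simp
    then obtain s where s: "s \<in> S" "\<phi> s = m" by blast
    have m: "m \<le> \<phi> x" if "x \<in> S" for x using that fin by (simp add: m_def)
    have "m > 0" using s by (auto simp: S_def)
    \<comment> \<open>Lowering \<open>\<phi>\<close> by its least positive value keeps it
      nonnegative and removes \<open>s\<close> from the support.\<close>
    define \<psi> where "\<psi> x = (if x \<in> S then \<phi> x - m else 0)" for x
    have sub: "{x \<in> V. \<psi> x > 0} \<subseteq> S" by (auto simp: \<psi>_def split: if_splits)
    moreover have "s \<notin> {x \<in> V. \<psi> x > 0}" using s by (simp add: \<psi>_def)
    ultimately have "card {x \<in> V. \<psi> x > 0} < card S"
      using s fin by (intro psubset_card_mono) auto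
    then have IH: "c * (\<Sum>x\<in>V. \<psi> x) \<le> (\<Sum>(x, y)\<in>E. max 0 (\<psi> x - \<psi> y))"
      unfolding S_def
      by (rule less.hyps) (use sub m less.prems(2) in \<open>auto simp: \<psi>_def S_def\<close>)
    have "(\<Sum>x\<in>V. \<phi> x) = (\<Sum>x\<in>V. \<psi> x + (if x \<in> S then m else 0))"
      using less.prems(1) by (intro sum.cong) (auto simp: \<psi>_def S_def order.antisym not_less)
    also have "\<dots> = (\<Sum>x\<in>V. \<psi> x) + m * card S"
      using finite_V by (simp add: sum.distrib S_def sum.If_cases Int_def)
    finally have 1: "(\<Sum>x\<in>V. \<phi> x) = (\<Sum>x\<in>V. \<psi> x) + m * card S" .
    \<comment> \<open>Only arcs leaving \<open>S\<close> lose \<open>m\<close>: differences inside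
      \<open>S\<close> are unchanged, and arcs starting outside \<open>S\<close> contribute nothing
      before or after.\<close>
    have "(\<Sum>(x, y)\<in>E. max 0 (\<phi> x - \<phi> y)) =
        (\<Sum>(x, y)\<in>E. max 0 (\<psi> x - \<psi> y) + (if (x, y) \<in> S \<times> (- S) then m else 0))"
    proof (intro sum.cong refl, clarify)
      fix x y assume "(x, y) \<in> E"
      then have "x \<in> V" "y \<in> V" using E_subset by auto
      moreover have "\<phi> z = 0" if "z \<in> V" "z \<notin> S" for z
        using less.prems(1)[of z] that by (auto simp: S_def)
      ultimately show "max 0 (\<phi> x - \<phi> y) =
          max 0 (\<psi> x - \<psi> y) + (if (x, y) \<in> S \<times> (- S) then m else 0)"
        using m[of x] m[of y] \<open>m > 0\<close> by (auto simp: \<psi>_def)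
    qed
    also have "\<dots> = (\<Sum>(x, y)\<in>E. max 0 (\<psi> x - \<psi> y)) +
        (\<Sum>p\<in>E. if p \<in> S \<times> (- S) then m else 0)"
      by (simp add: case_prod_beta sum.distrib mem_Times_iff)
    also have "(\<Sum>p\<in>E. if p \<in> S \<times> (- S) then m else 0) = m * card (E \<inter> S \<times> (- S))"
      using finite_E by (simp add: sum.If_cases Int_def)
    finally have 2: "(\<Sum>(x, y)\<in>E. max 0 (\<phi> x - \<phi> y)) =
      (\<Sum>(x, y)\<in>E. max 0 (\<psi> x - \<psi> y)) + m * card (E \<inter> S \<times> (- S))" .
    have "m * (c * card S) \<le> m * card (E \<inter> S \<times> (- S))"
      using less.prems(2)[of S] \<open>m > 0\<close> by (simp add: S_def)
    with IH show ?thesis unfolding 1 2 by (simp add: algebra_simps)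
  qed
qed

text \<open>The coarea inequality is applied to the square of \<open>h\<close>, which has the same
  support as \<open>h\<close>. Factoring the difference of squares and using Cauchy-Schwarz leaves
  the energy times the sum of \<open>(h x + h y)\<^sup>2\<close>, and the latter is at most 4 D
  times the sum of squares. One factor of that sum then cancels.\<close>

lemma cheeger_half_support:
  fixes h :: "'a \<Rightarrow> real"
  assumes "c \<ge> 0" "\<And>x. h x \<ge> 0"
    and exp: "\<And>A. A \<subseteq> {x \<in> V. h x > 0} \<Longrightarrow> c * real (card A) \<le> real (card (E \<inter> A \<times> (- A)))"
  shows "c\<^sup>2 * (\<Sum>x\<in>V. (h x)\<^sup>2) \<le> 4 * real D * (\<Sum>(x, y)\<in>E. (h x - h y)\<^sup>2)"
proof -
  define S where "S = (\<Sum>x\<in>V. (h x)\<^sup>2)"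
  define Q where "Q = (\<Sum>(x, y)\<in>E. (h x - h y)\<^sup>2)"
  have "S \<ge> 0" by (simp add: S_def sum_nonneg)
  have "Q \<ge> 0" by (simp add: Q_def sum_nonneg case_prod_beta)
  have "c * S \<le> (\<Sum>(x, y)\<in>E. max 0 ((h x)\<^sup>2 - (h y)\<^sup>2))"
    unfolding S_def by (rule coarea_inequality) (use exp assms(2) in \<open>auto simp: order_less_le\<close>)
  also have "\<dots> \<le> (\<Sum>(x, y)\<in>E. \<bar>h x - h y\<bar> * (h x + h y))"
  proof (intro sum_mono, clarify)
    fix x y
    have "(h x)\<^sup>2 - (h y)\<^sup>2 = (h x - h y) * (h x + h y)" by (simp add: power2_eq_square algebra_simps)
    then show "max 0 ((h x)\<^sup>2 - (h y)\<^sup>2) \<le> \<bar>h x - h y\<bar> * (h x + h y)"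
      using assms(2)[of x] assms(2)[of y] by (simp add: mult_right_mono)
  qed
  finally have "(c * S)\<^sup>2 \<le> (\<Sum>(x, y)\<in>E. \<bar>h x - h y\<bar> * (h x + h y))\<^sup>2"
    using \<open>S \<ge> 0\<close> \<open>c \<ge> 0\<close> by (intro power_mono) auto
  also have "\<dots> \<le> (\<Sum>p\<in>E. \<bar>h (fst p) - h (snd p)\<bar>\<^sup>2) * (\<Sum>p\<in>E. (h (fst p) + h (snd p))\<^sup>2)"
    unfolding case_prod_beta by (rule Cauchy_Schwarz_ineq_sum)
  also have "\<dots> = Q * (\<Sum>(x, y)\<in>E. (h x + h y)\<^sup>2)"
    by (simp add: Q_def case_prod_beta)
  also have "(\<Sum>(x, y)\<in>E. (h x + h y)\<^sup>2) \<le> (\<Sum>(x, y)\<in>E. 2 * (h x)\<^sup>2 + 2 * (h y)\<^sup>2)"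
  proof (intro sum_mono, clarify)
    fix x y
    show "(h x + h y)\<^sup>2 \<le> 2 * (h x)\<^sup>2 + 2 * (h y)\<^sup>2"
      using sum_squares_bound[of "h x" "h y"] by (simp add: power2_sum)
  qed
  also have "\<dots> = 2 * (\<Sum>(x, y)\<in>E. (h x)\<^sup>2) + 2 * (\<Sum>(x, y)\<in>E. (h y)\<^sup>2)"
    by (simp add: case_prod_beta sum.distrib sum_distrib_left)
  also have "(\<Sum>(x, y)\<in>E. (h y)\<^sup>2) = (\<Sum>(x, y)\<in>E. (h x)\<^sup>2)"
    by (rule sum_E_swap)
  also have "2 * (\<Sum>(x, y)\<in>E. (h x)\<^sup>2) + 2 * (\<Sum>(x, y)\<in>E. (h x)\<^sup>2) \<le> 4 * (real D * S)"
    using sum_E_fst_le[of "\<lambda>x. (h x)\<^sup>2"] by (simp add: S_def)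
  finally have "(c * S)\<^sup>2 \<le> Q * (4 * (real D * S))"
    using \<open>Q \<ge> 0\<close> by (simp add: mult_left_mono)
  then have "S * (c\<^sup>2 * S) \<le> S * (4 * real D * Q)"
    by (simp add: power2_eq_square algebra_simps)
  then have "c\<^sup>2 * S \<le> 4 * real D * Q"
    using \<open>S \<ge> 0\<close> \<open>Q \<ge> 0\<close> by (cases "S = 0") (auto simp: mult_le_cancel_left)
  then show ?thesis by (simp add: S_def Q_def)
qed

end

text \<open>Take the smallest value of \<open>f\<close> with at most half of the points strictly
  above it. The next lower value fails this test, so more than half of the points lie above that
  value; the points below the median are disjoint from these.\<close>

lemma median_exists:
  fixes f :: "'a \<Rightarrow> real"
  assumes "finite V"
  obtains m where "2 * card {x \<in> V. f x > m} \<le> card V" "2 * card {x \<in> V. f x < m} \<le> card V"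
proof (cases "V = {}")
  case True
  then show ?thesis using that[of 0] by simp
next
  case False
  define C where "C = {m \<in> f ` V. 2 * card {x \<in> V. f x > m} \<le> card V}"
  have C: "finite C" using assms by (simp add: C_def)
  have "Max (f ` V) \<in> f ` V" using False assms by simp
  moreover have "{x \<in> V. f x > Max (f ` V)} = {}" using assms by (auto simp: not_less)
  ultimately have "Max (f ` V) \<in> C"
    unfolding C_def mem_Collect_eq by (metis card.empty mult_0_right zero_le)
  then have "Min C \<in> C" using C by (intro Min_in) auto
  define m where "m = Min C"
  have m: "2 * card {x \<in> V. f x > m} \<le> card V" using \<open>Min C \<in> C\<close> by (auto simp: C_def m_def)
  have "2 * card {x \<in> V. f x < m} \<le> card V"
  proof (cases "{x \<in> V. f x < m} = {}")
    case nonempty: False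
    define B where "B = {x \<in> V. f x < m}"
    have B: "finite B" "B \<noteq> {}" using assms nonempty by (auto simp: B_def)
    define m' where "m' = Max (f ` B)"
    have m'in: "m' \<in> f ` B" using B by (simp add: m'_def)
    have le: "f x \<le> m'" if "x \<in> B" for x using B that by (simp add: m'_def)
    have "m' < m" using m'in by (auto simp: B_def)
    then have "m' \<notin> C" using C by (metis Min_le m_def not_le)
    moreover have "m' \<in> f ` V" using m'in by (auto simp: B_def)
    ultimately have "2 * card {x \<in> V. f x > m'} > card V" by (simp add: C_def)
    moreover have "card {x \<in> V. f x > m'} + card B = card ({x \<in> V. f x > m'} \<union> B)"
      using assms le by (intro card_Un_disjoint[symmetric]) (force simp: B_def)+
    moreover have "\<dots> \<le> card V" using assms by (intro card_mono) (auto simp: B_def)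
    ultimately show ?thesis unfolding B_def by linarith
  qed (metis card.empty mult_0_right zero_le)
  with m show ?thesis by (rule that)
qed

context bounded_degree_relation
begin

text \<open>Subtracting a median splits \<open>f\<close> into a positive part \<open>p\<close> and a
  negative part \<open>q\<close>, each supported on at most half of the vertices, where expansion is
  available. Cheeger's inequality applies to both parts.\<close>

lemma poincare_real:
  fixes f :: "'a \<Rightarrow> real"
  assumes "c \<ge> 0"
    and exp: "\<And>A. A \<subseteq> V \<Longrightarrow> 2 * card A \<le> card V \<Longrightarrow>
      c * real (card A) \<le> real (card (E \<inter> A \<times> (- A)))"
    and mean: "(\<Sum>x\<in>V. f x) = 0"
  shows "c\<^sup>2 * (\<Sum>x\<in>V. (f x)\<^sup>2) \<le> 4 * real D * (\<Sum>(x, y)\<in>E. (f x - f y)\<^sup>2)"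
proof -
  obtain m where m: "2 * card {x \<in> V. f x > m} \<le> card V" "2 * card {x \<in> V. f x < m} \<le> card V"
    using median_exists[OF finite_V, of f] by blast
  define p where "p x = max 0 (f x - m)" for x
  define q where "q x = max 0 (m - f x)" for x
  have p: "c\<^sup>2 * (\<Sum>x\<in>V. (p x)\<^sup>2) \<le> 4 * real D * (\<Sum>(x, y)\<in>E. (p x - p y)\<^sup>2)"
  proof (rule cheeger_half_support[OF \<open>c \<ge> 0\<close>])
    fix A assume A: "A \<subseteq> {x \<in> V. p x > 0}"
    then have "card A \<le> card {x \<in> V. f x > m}"
      using finite_V by (intro card_mono) (auto simp: p_def)
    then show "c * real (card A) \<le> real (card (E \<inter> A \<times> (- A)))" using A m by (intro exp) auto
  qed (simp add: p_def)
  have q: "c\<^sup>2 * (\<Sum>x\<in>V. (q x)\<^sup>2) \<le> 4 * real D * (\<Sum>(x, y)\<in>E. (q x - q y)\<^sup>2)"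
  proof (rule cheeger_half_support[OF \<open>c \<ge> 0\<close>])
    fix A assume A: "A \<subseteq> {x \<in> V. q x > 0}"
    then have "card A \<le> card {x \<in> V. f x < m}"
      using finite_V by (intro card_mono) (auto simp: q_def)
    then show "c * real (card A) \<le> real (card (E \<inter> A \<times> (- A)))" using A m by (intro exp) auto
  qed (simp add: q_def)
  \<comment> \<open>Mean zero kills the cross term, so subtracting a constant can only increase the
    sum of squares.\<close>
  have "(\<Sum>x\<in>V. (f x)\<^sup>2) \<le> (\<Sum>x\<in>V. (f x)\<^sup>2) - 2 * m * (\<Sum>x\<in>V. f x) + card V * m\<^sup>2"
    by (simp add: mean)
  also have "\<dots> = (\<Sum>x\<in>V. (f x - m)\<^sup>2)"
    by (simp add: power2_diff sum.distrib sum_subtractf sum_distrib_left sum_distrib_right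
        algebra_simps)
  also have "\<dots> = (\<Sum>x\<in>V. (p x)\<^sup>2 + (q x)\<^sup>2)"
    by (intro sum.cong) (auto simp: p_def q_def max_def power2_commute)
  finally have "c\<^sup>2 * (\<Sum>x\<in>V. (f x)\<^sup>2) \<le> c\<^sup>2 * (\<Sum>x\<in>V. (p x)\<^sup>2 + (q x)\<^sup>2)"
    by (intro mult_left_mono) auto
  also have "\<dots> \<le> 4 * real D * (\<Sum>(x, y)\<in>E. (p x - p y)\<^sup>2 + (q x - q y)\<^sup>2)"
    using p q by (simp add: case_prod_beta sum.distrib algebra_simps)
  also have "\<dots> \<le> 4 * real D * (\<Sum>(x, y)\<in>E. (f x - f y)\<^sup>2)"
  proof (intro mult_left_mono sum_mono, clarify)
    fix x y
    \<comment> \<open>\<open>p\<close> is nondecreasing and \<open>q\<close> nonincreasing as a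
      function of \<open>f\<close>, so the increments have opposite signs and the cross term may be
      dropped.\<close>
    have "(p x - p y) * (q x - q y) \<le> 0"
      by (auto simp: p_def q_def max_def mult_le_0_iff)
    moreover have "f x - f y = (p x - p y) - (q x - q y)" by (simp add: p_def q_def max_def)
    ultimately show "(p x - p y)\<^sup>2 + (q x - q y)\<^sup>2 \<le> (f x - f y)\<^sup>2"
      using power2_diff[of "p x - p y" "q x - q y"] by (simp only: mult.assoc)
  qed simp
  finally show ?thesis .
qed

lemma poincare:
  fixes f :: "'a \<Rightarrow> complex"
  assumes "c \<ge> 0"
    and exp: "\<And>A. A \<subseteq> V \<Longrightarrow> 2 * card A \<le> card V \<Longrightarrow>
      c * real (card A) \<le> real (card (E \<inter> A \<times> (- A)))"
    and mean: "(\<Sum>x\<in>V. f x) = 0"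
  shows "c\<^sup>2 * (\<Sum>x\<in>V. (cmod (f x))\<^sup>2) \<le> 4 * real D * (\<Sum>(x, y)\<in>E. (cmod (f x - f y))\<^sup>2)"
proof -
  have "(\<Sum>x\<in>V. Re (f x)) = 0" "(\<Sum>x\<in>V. Im (f x)) = 0"
    using mean by (metis Re_sum zero_complex.sel(1)) (metis mean Im_sum zero_complex.sel(2))
  from poincare_real[OF \<open>c \<ge> 0\<close> exp this(1)] poincare_real[OF \<open>c \<ge> 0\<close> exp this(2)]
  show ?thesis by (simp add: cmod_power2 case_prod_beta sum.distrib algebra_simps)
qed

text \<open>Differences along opposite arcs cancel. In particular functions of mean zero stay of
  mean zero under iteration.\<close>

lemma sum_smoothing: "(\<Sum>x\<in>V. smoothing E D f x) = (\<Sum>x\<in>V. f x)"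
proof -
  have "(\<Sum>x\<in>V. \<Sum>y\<in>E `` {x}. f x - f y) = (\<Sum>(x, y)\<in>E. f x) - (\<Sum>(x, y)\<in>E. f y)"
    unfolding sum_E_iterated[symmetric] by (simp add: case_prod_beta sum_subtractf)
  also have "(\<Sum>(x, y)\<in>E. f y) = (\<Sum>(x, y)\<in>E. f x)" by (rule sum_E_swap)
  finally show ?thesis by (simp add: smoothing_def sum_subtractf flip: sum_divide_distrib)
qed

text \<open>Write Q for the energy and expand the square of f - L/(2D). The cross term removes
  Q/(2D), and the quadratic term gives back at most Q/(4D) by Cauchy-Schwarz over at most D
  neighbours.\<close>

lemma smoothing_energy:
  assumes "D > 0"
  shows "(\<Sum>x\<in>V. (cmod (smoothing E D f x))\<^sup>2) \<le>
    (\<Sum>x\<in>V. (cmod (f x))\<^sup>2) - (\<Sum>(x, y)\<in>E. (cmod (f x - f y))\<^sup>2) / (4 * real D)"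
proof -
  define L where "L x = (\<Sum>y\<in>E `` {x}. f x - f y)" for x
  define Q where "Q = (\<Sum>(x, y)\<in>E. (cmod (f x - f y))\<^sup>2)"
  have LL: "(\<Sum>x\<in>V. (cmod (L x))\<^sup>2) \<le> D * Q"
  proof -
    have "(cmod (L x))\<^sup>2 \<le> real D * (\<Sum>y\<in>E `` {x}. (cmod (f x - f y))\<^sup>2)" if "x \<in> V" for x
    proof -
      have "(cmod (L x))\<^sup>2 \<le> (\<Sum>y\<in>E `` {x}. cmod (f x - f y))\<^sup>2"
        unfolding L_def by (intro power_mono norm_sum) simp
      also have "\<dots> \<le> (\<Sum>y\<in>E `` {x}. (cmod (f x - f y))\<^sup>2) * card (E `` {x})"
        by (rule sum_squared_le_sum_of_squares)
      also have "\<dots> \<le> (\<Sum>y\<in>E `` {x}. (cmod (f x - f y))\<^sup>2) * D"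
        using degree_le[OF that] by (intro mult_left_mono sum_nonneg) auto
      finally show ?thesis by (simp add: mult.commute)
    qed
    then have "(\<Sum>x\<in>V. (cmod (L x))\<^sup>2) \<le> (\<Sum>x\<in>V. real D * (\<Sum>y\<in>E `` {x}. (cmod (f x - f y))\<^sup>2))"
      by (rule sum_mono)
    also have "\<dots> = D * Q" by (simp add: Q_def sum_E_iterated sum_distrib_left)
    finally show ?thesis .
  qed
  \<comment> \<open>Summation by parts: adding the two orientations of every arc turns the pairing
    of \<open>f\<close> with its Laplacian into the energy.\<close>
  have fL: "2 * (\<Sum>x\<in>V. Re (cnj (f x) * L x)) = Q"
  proof -
    have "(\<Sum>x\<in>V. Re (cnj (f x) * L x)) = (\<Sum>(x, y)\<in>E. Re (cnj (f x) * (f x - f y)))"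
      unfolding sum_E_iterated L_def by (simp only: sum_distrib_left Re_sum)
    moreover have "\<dots> = (\<Sum>(x, y)\<in>E. Re (cnj (f y) * (f y - f x)))" by (rule sum_E_swap)
    ultimately have "2 * (\<Sum>x\<in>V. Re (cnj (f x) * L x)) =
       (\<Sum>(x, y)\<in>E. Re (cnj (f x) * (f x - f y))) + (\<Sum>(x, y)\<in>E. Re (cnj (f y) * (f y - f x)))"
      by linarith
    also have "\<dots> = Q"
      unfolding Q_def sum.distrib[symmetric] case_prod_beta
      by (intro sum.cong refl) (simp add: cmod_power2, simp add: power2_eq_square algebra_simps)
    finally show ?thesis .
  qed
  have "(\<Sum>x\<in>V. (cmod (smoothing E D f x))\<^sup>2) =
    (\<Sum>x\<in>V. (cmod (f x))\<^sup>2 - Re (cnj (f x) * L x) / D + (cmod (L x))\<^sup>2 / (4 * (real D)\<^sup>2))"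
  proof (intro sum.cong refl)
    fix x
    have Re: "Re (smoothing E D f x) = Re (f x) - Re (L x) / (2 * D)"
     and Im: "Im (smoothing E D f x) = Im (f x) - Im (L x) / (2 * D)"
      by (simp_all add: smoothing_def L_def Re_divide_of_nat Im_divide_of_nat del: of_nat_mult)
    show "(cmod (smoothing E D f x))\<^sup>2 =
      (cmod (f x))\<^sup>2 - Re (cnj (f x) * L x) / D + (cmod (L x))\<^sup>2 / (4 * (real D)\<^sup>2)"
      using assms unfolding cmod_power2 Re Im
      by (simp add: power2_diff) (simp add: field_simps power2_eq_square)
  qed
  also have "\<dots> = (\<Sum>x\<in>V. (cmod (f x))\<^sup>2) - (Q / 2) / D + (\<Sum>x\<in>V. (cmod (L x))\<^sup>2) / (4 * (real D)\<^sup>2)"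
  proof -
    have "(\<Sum>x\<in>V. Re (cnj (f x) * L x)) = Q / 2" using fL by linarith
    then show ?thesis by (simp only: sum.distrib sum_subtractf sum_divide_distrib[symmetric])
  qed
  also have "\<dots> \<le> (\<Sum>x\<in>V. (cmod (f x))\<^sup>2) - (Q / 2) / D + (D * Q) / (4 * (real D)\<^sup>2)"
    using LL by (intro add_left_mono divide_right_mono) auto
  also have "\<dots> = (\<Sum>x\<in>V. (cmod (f x))\<^sup>2) - Q / (4 * D)"
    using assms by (simp add: field_simps power2_eq_square)
  finally show ?thesis by (simp add: Q_def)
qed

lemma smoothing_le:
  assumes "D > 0"
  shows "(\<Sum>x\<in>V. (cmod (smoothing E D f x))\<^sup>2) \<le> (\<Sum>x\<in>V. (cmod (f x))\<^sup>2)"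
proof -
  have "(\<Sum>(x, y)\<in>E. (cmod (f x - f y))\<^sup>2) / (4 * real D) \<ge> 0"
    by (intro divide_nonneg_nonneg sum_nonneg) auto
  with smoothing_energy[OF assms, of f] show ?thesis by linarith
qed

text \<open>The Poincare inequality bounds the energy loss from below; its factor 4 D and the 4 D of
  \<open>smoothing_energy\<close> multiply to the denominator.\<close>

lemma smoothing_contraction:
  assumes "D > 0" "c \<ge> 0"
    and exp: "\<And>A. A \<subseteq> V \<Longrightarrow> 2 * card A \<le> card V \<Longrightarrow>
      c * real (card A) \<le> real (card (E \<inter> A \<times> (- A)))"
    and mean: "(\<Sum>x\<in>V. f x) = 0"
  shows "(\<Sum>x\<in>V. (cmod (smoothing E D f x))\<^sup>2) \<le>
    (1 - c\<^sup>2 / (16 * (real D)\<^sup>2)) * (\<Sum>x\<in>V. (cmod (f x))\<^sup>2)"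
proof -
  have "c\<^sup>2 / (16 * (real D)\<^sup>2) * (\<Sum>x\<in>V. (cmod (f x))\<^sup>2) \<le>
      (\<Sum>(x, y)\<in>E. (cmod (f x - f y))\<^sup>2) / (4 * real D)"
    using poincare[OF assms(2-4)] \<open>D > 0\<close> by (simp add: field_simps power2_eq_square)
  with smoothing_energy[OF \<open>D > 0\<close>, of f] show ?thesis by (simp add: left_diff_distrib)
qed

end

section \<open>Growth of neighbourhoods, and reduction of expansion to sets of proportional size by
  translates\<close>

section \<open>Expansion in vertex-transitive graphs\<close>

primrec neighbourhood :: "('a \<times> 'a) set \<Rightarrow> nat \<Rightarrow> 'a set \<Rightarrow> 'a set" where
  "neighbourhood E 0 U = U"
| "neighbourhood E (Suc r) U = neighbourhood E r U \<union> E `` neighbourhood E r U"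

lemma relpow_in_neighbourhood:
  assumes "(u, v) \<in> E ^^ k" "u \<in> U" "k \<le> r"
  shows "v \<in> neighbourhood E r U"
proof -
  have "v \<in> neighbourhood E k U" using assms(1)
    by (induction k arbitrary: v) (use assms(2) in auto)
  with \<open>k \<le> r\<close> show ?thesis by (induction r rule: dec_induct) auto
qed

text \<open>A walk leaving \<open>U\<close> first enters the boundary, so everything gained within
  \<open>r\<close> steps lies within \<open>r\<close> steps of the boundary. Thus the boundary
  controls how fast \<open>U\<close> grows.\<close>

lemma neighbourhood_subset_boundary:
  assumes "E \<subseteq> V \<times> V"
  shows "neighbourhood E r U \<subseteq> U \<union> neighbourhood E r {v \<in> V - U. \<exists>u\<in>U. (u, v) \<in> E}"
    (is "_ \<subseteq> _ \<union> neighbourhood E r ?B")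
proof (induction r)
  case (Suc r)
  have "?B \<subseteq> neighbourhood E r ?B" by (induction r) auto
  with Suc assms show ?case by auto blast
qed simp

text \<open>Containment in \<open>V\<close> is part of the induction because the degree bound holds
  only for vertices of \<open>V\<close>.\<close>

lemma (in bounded_degree_relation) card_neighbourhood_le:
  assumes "B \<subseteq> V"
  shows "neighbourhood E r B \<subseteq> V \<and> card (neighbourhood E r B) \<le> (D + 1) ^ r * card B"
proof (induction r)
  case (Suc r)
  let ?N = "neighbourhood E r B"
  have fin: "finite ?N" using Suc finite_V finite_subset by blast
  have "card (E `` ?N) = card (\<Union>x\<in>?N. E `` {x})" by (metis Image_eq_UN)
  also have "\<dots> \<le> (\<Sum>x\<in>?N. card (E `` {x}))" by (rule card_UN_le[OF fin])
  also have "\<dots> \<le> (\<Sum>x\<in>?N. D)" using Suc degree_le by (intro sum_mono) auto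
  finally have "card (?N \<union> E `` ?N) \<le> (D + 1) * card ?N"
    using card_Un_le[of ?N "E `` ?N"] by (simp add: mult.commute)
  also have "\<dots> \<le> (D + 1) * ((D + 1) ^ r * card B)" using Suc by (intro mult_left_mono) auto
  finally have "card (?N \<union> E `` ?N) \<le> (D + 1) ^ Suc r * card B" by (simp only: power_Suc mult.assoc)
  then show ?case using Suc E_subset by auto
qed (use assms in simp)

text \<open>\<open>graph_automorphism\<close> leaves values off the vertex set arbitrary. Requiring
  the identity there gives one function per automorphism, hence a finite set over which one can
  average.\<close>

definition automorphism_permutations :: "'a pair_pre_digraph \<Rightarrow> ('a \<Rightarrow> 'a) set" where
  "automorphism_permutations G =
    {g. g permutes pverts G \<and> (\<forall>u v. (g u, g v) \<in> parcs G \<longleftrightarrow> (u, v) \<in> parcs G)}"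

context pair_graph
begin

abbreviation "\<Gamma> \<equiv> automorphism_permutations G"

lemma finite_automorphism_permutations: "finite \<Gamma>"
  using finite_permutations[OF pair_finite_verts]
  by (rule rev_finite_subset) (auto simp: automorphism_permutations_def)

lemma id_in_automorphism_permutations: "id \<in> \<Gamma>"
  by (simp add: automorphism_permutations_def permutes_id)

lemma automorphism_permutation_transitive:
  assumes "vertex_transitive G" "u \<in> pverts G" "v \<in> pverts G"
  obtains g where "g \<in> \<Gamma>" "g u = v"
proof -
  obtain \<phi> where \<phi>: "graph_automorphism G \<phi>" "\<phi> u = v"
    using assms unfolding vertex_transitive_def by blast
  define g where "g x = (if x \<in> pverts G then \<phi> x else x)" for x
  have "bij_betw g (pverts G) (pverts G)"
    using \<phi> by (subst bij_betw_cong[of _ _ \<phi>]) (auto simp: g_def graph_automorphism_def)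
  then have "g permutes pverts G"
    by (rule bij_imp_permutes) (simp add: g_def)
  moreover have "(g u, g v) \<in> parcs G \<longleftrightarrow> (u, v) \<in> parcs G" for u v
  proof (cases "u \<in> pverts G \<and> v \<in> pverts G")
    case True
    then show ?thesis using \<phi> by (simp add: g_def graph_automorphism_def)
  next
    case False
    then have "g u \<notin> pverts G \<or> g v \<notin> pverts G" by (auto simp: g_def)
    with False show ?thesis using in_arcsD1 in_arcsD2 by blast
  qed
  ultimately have "g \<in> \<Gamma>" by (simp add: automorphism_permutations_def)
  then show ?thesis using that[of g] \<phi> assms by (simp add: g_def)
qed

text \<open>Orbit-stabilizer counting: composing with an automorphism that takes \<open>u\<close> to
  \<open>v\<close> injects the transporters to \<open>u\<close> into those to \<open>v\<close>. All
  of them thus have equal size, and they partition the group.\<close>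

lemma card_transporter:
  assumes "vertex_transitive G" "a \<in> pverts G" "u \<in> pverts G"
  shows "card (pverts G) * card {g \<in> \<Gamma>. g a = u} = card \<Gamma>"
proof -
  have le: "card {g \<in> \<Gamma>. g a = u} \<le> card {g \<in> \<Gamma>. g a = v}"
    if uv: "u \<in> pverts G" "v \<in> pverts G" for u v
  proof -
    obtain h where h: "h \<in> \<Gamma>" "h u = v"
      using automorphism_permutation_transitive[OF assms(1) uv] by blast
    have "inj h" using h by (auto simp: automorphism_permutations_def dest: permutes_inj)
    then have "inj_on ((\<circ>) h) {g \<in> \<Gamma>. g a = u}"
      by (intro inj_onI) (metis fun.inj_map injD)
    moreover have "(\<circ>) h ` {g \<in> \<Gamma>. g a = u} \<subseteq> {g \<in> \<Gamma>. g a = v}"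
      using h by (auto simp: automorphism_permutations_def permutes_compose)
    ultimately show ?thesis
      using finite_automorphism_permutations by (intro card_inj_on_le) auto
  qed
  have "\<Gamma> = (\<Union>v\<in>pverts G. {g \<in> \<Gamma>. g a = v})"
    using assms(2) by (auto simp: automorphism_permutations_def permutes_in_image)
  then have "card \<Gamma> = card (\<Union>v\<in>pverts G. {g \<in> \<Gamma>. g a = v})" by simp
  also have "\<dots> = (\<Sum>v\<in>pverts G. card {g \<in> \<Gamma>. g a = v})"
    using pair_finite_verts finite_automorphism_permutations
    by (intro card_UN_disjoint) auto
  also have "\<dots> = (\<Sum>v\<in>pverts G. card {g \<in> \<Gamma>. g a = u})"
    using le assms(3) by (intro sum.cong refl order.antisym) auto
  finally show ?thesis by simp
qed

text \<open>Counting triples \<open>(g, a, u)\<close> with \<open>g a = u\<close> shows that the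
  average overlap over the group is |A| |U| / |V|; some automorphism does not exceed the
  average.\<close>

lemma translate_with_small_overlap:
  assumes "vertex_transitive G" "A \<subseteq> pverts G" "U \<subseteq> pverts G"
  obtains g where "g \<in> \<Gamma>" "card (pverts G) * card (g ` A \<inter> U) \<le> card A * card U"
proof -
  have fin: "finite A" "finite U"
    using assms pair_finite_verts finite_subset by blast+
  have overlap: "card (g ` A \<inter> U) = (\<Sum>a\<in>A. \<Sum>u\<in>U. if g a = u then 1 else 0)" if "g \<in> \<Gamma>" for g
  proof -
    have "inj g" using that by (auto simp: automorphism_permutations_def dest: permutes_inj)
    have "g ` A \<inter> U = g ` {a \<in> A. g a \<in> U}" by auto
    then have "card (g ` A \<inter> U) = card {a \<in> A. g a \<in> U}"
      using \<open>inj g\<close> by (simp add: card_image inj_on_subset)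
    also have "\<dots> = (\<Sum>a\<in>A. if g a \<in> U then 1 else 0)"
      using fin by (simp add: sum.If_cases Int_def)
    finally show ?thesis using fin by simp
  qed
  have "card (pverts G) * (\<Sum>g\<in>\<Gamma>. card (g ` A \<inter> U)) =
      card (pverts G) * (\<Sum>g\<in>\<Gamma>. \<Sum>a\<in>A. \<Sum>u\<in>U. if g a = u then 1 else 0)"
    by (simp add: overlap)
  also have "(\<Sum>g\<in>\<Gamma>. \<Sum>a\<in>A. \<Sum>u\<in>U. if g a = u then 1 else (0::nat)) =
      (\<Sum>a\<in>A. \<Sum>u\<in>U. \<Sum>g\<in>\<Gamma>. if g a = u then 1 else 0)"
    by (subst sum.swap, intro sum.cong refl, rule sum.swap)
  also have "\<dots> = (\<Sum>a\<in>A. \<Sum>u\<in>U. card {g \<in> \<Gamma>. g a = u})"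
    using finite_automorphism_permutations by (simp add: sum.If_cases Int_def)
  also have "card (pverts G) * \<dots> = (\<Sum>a\<in>A. \<Sum>u\<in>U. card \<Gamma>)"
    unfolding sum_distrib_left using assms card_transporter
    by (intro sum.cong refl) blast
  finally have avg: "(\<Sum>g\<in>\<Gamma>. card (pverts G) * card (g ` A \<inter> U)) = (\<Sum>g\<in>\<Gamma>. card A * card U)"
    by (simp add: sum_distrib_left)
  have "\<exists>g\<in>\<Gamma>. card (pverts G) * card (g ` A \<inter> U) \<le> card A * card U"
  proof (rule ccontr)
    assume "\<not> ?thesis"
    then have "(\<Sum>g\<in>\<Gamma>. card A * card U) < (\<Sum>g\<in>\<Gamma>. card (pverts G) * card (g ` A \<inter> U))"
      using finite_automorphism_permutations id_in_automorphism_permutations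
      by (intro sum_strict_mono) auto
    with avg show False by simp
  qed
  then show ?thesis using that by blast
qed

lemma vertex_boundary_image:
  assumes "g \<in> \<Gamma>"
  shows "vertex_boundary G (g ` A) = g ` vertex_boundary G A"
proof -
  have g: "g permutes pverts G" "\<And>u v. (g u, g v) \<in> parcs G \<longleftrightarrow> (u, v) \<in> parcs G"
    using assms by (auto simp: automorphism_permutations_def)
  have "w \<in> vertex_boundary G (g ` A) \<longleftrightarrow> inv g w \<in> vertex_boundary G A" for w
  proof -
    obtain z where "w = g z" using permutes_surj[OF g(1)] by (metis surjD)
    then show ?thesis
      using permutes_in_image[OF g(1)] inj_eq[OF permutes_inj[OF g(1)]]
      by (auto simp: vertex_boundary_def g(2) permutes_inverses[OF g(1)] image_iff)
  qed
  then have "vertex_boundary G (g ` A) = inv g -` vertex_boundary G A" by blast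
  then show ?thesis
    using bij_vimage_eq_inv_image[OF permutes_bij[OF permutes_inv[OF g(1)]]]
    by (simp add: permutes_inv_inv[OF g(1)])
qed

text \<open>Greedy construction: as long as \<open>U\<close> has fewer than \<open>n/4\<close> vertices, some translate of \<open>A\<close>
  meets \<open>U\<close> in at most \<open>|A|/4\<close> vertices.  Adding it enlarges \<open>U\<close> by at least \<open>|A|/2\<close>
  and its boundary by at most \<open>|\<partial>A|\<close>.\<close>

lemma union_of_translates:
  assumes "vertex_transitive G" "A \<subseteq> pverts G" "A \<noteq> {}" "4 * card A \<le> card (pverts G)"
  obtains U where "U \<subseteq> pverts G" "card (pverts G) \<le> 4 * card U" "2 * card U \<le> card (pverts G)"
    "card (vertex_boundary G U) * card A \<le> 2 * card U * card (vertex_boundary G A)"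
proof -
  let ?n = "card (pverts G)"
  \<comment> \<open>The greedy process becomes an extremal argument: a member of \<open>C\<close> of
    maximal size cannot be enlarged. The last condition is the comparison of isoperimetric ratios
    cleared of denominators, so that the empty set qualifies.\<close>
  define C where "C = {U. U \<subseteq> pverts G \<and> 2 * card U \<le> ?n \<and>
    card (vertex_boundary G U) * card A \<le> 2 * card U * card (vertex_boundary G A)}"
  have "finite C" using pair_finite_verts by (simp add: C_def)
  moreover have "{} \<in> C" by (simp add: C_def vertex_boundary_def)
  ultimately have "Max (card ` C) \<in> card ` C" by (intro Max_in) auto
  then obtain U where U: "U \<in> C" and cU: "card U = Max (card ` C)" by auto
  have max: "card W \<le> card U" if "W \<in> C" for W
    unfolding cU using \<open>finite C\<close> that by (intro Max_ge) auto
  have "?n \<le> 4 * card U"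
  proof (rule ccontr)
    assume small: "\<not> ?n \<le> 4 * card U"
    have fin: "finite A" "finite U" "finite (vertex_boundary G B)" for B
      using U assms(2) pair_finite_verts finite_subset[of _ "pverts G"]
      by (auto simp: C_def vertex_boundary_def)
    have A0: "card A > 0" using fin assms(3) by (simp add: card_gt_0_iff)
    obtain g where g: "g \<in> \<Gamma>" and le: "?n * card (g ` A \<inter> U) \<le> card A * card U"
      using translate_with_small_overlap[OF assms(1,2)] U unfolding C_def by blast
    have perm: "g permutes pverts G" using g by (simp add: automorphism_permutations_def)
    then have inj: "inj g" by (rule permutes_inj)
    have "?n * (4 * card (g ` A \<inter> U)) \<le> card A * (4 * card U)" using le by simp
    also have "\<dots> \<le> card A * ?n" using small by (intro mult_left_mono) auto
    finally have overlap: "4 * card (g ` A \<inter> U) \<le> card A" using small by simp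
    define W where "W = U \<union> g ` A"
    have "card (g ` A) = card A" using inj by (simp add: card_image inj_on_subset)
    then have cW: "card W + card (g ` A \<inter> U) = card U + card A"
      using card_Un_Int[of U "g ` A"] fin by (simp add: W_def Int_commute)
    have "card (vertex_boundary G W) \<le> card (vertex_boundary G U \<union> vertex_boundary G (g ` A))"
      using fin by (intro card_mono) (auto simp: W_def vertex_boundary_def)
    also have "\<dots> \<le> card (vertex_boundary G U) + card (vertex_boundary G (g ` A))"
      by (rule card_Un_le)
    also have "card (vertex_boundary G (g ` A)) = card (vertex_boundary G A)"
      unfolding vertex_boundary_image[OF g] using inj by (simp add: card_image inj_on_subset)
    finally have "card (vertex_boundary G W) * card A \<le>
        card (vertex_boundary G U) * card A + card A * card (vertex_boundary G A)"
      by (metis add_mult_distrib mult.commute mult_le_mono1)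
    also have "\<dots> \<le> 2 * card U * card (vertex_boundary G A) + card A * card (vertex_boundary G A)"
      using U by (simp add: C_def)
    also have "\<dots> = (2 * card U + card A) * card (vertex_boundary G A)" by (simp add: add_mult_distrib)
    \<comment> \<open>The overlap is at most a quarter of |A|, so |W| exceeds |U| by at least
      3|A|/4; half of |A| would be enough here.\<close>
    also have "\<dots> \<le> 2 * card W * card (vertex_boundary G A)"
      using cW overlap by (intro mult_right_mono) auto
    \<comment> \<open>The size constraint survives because both \<open>U\<close> and
      \<open>A\<close> have at most a quarter of the vertices.\<close>
    finally have "W \<in> C"
      using cW small assms(2,4) U perm by (auto simp: C_def W_def permutes_in_image)
    then show False using max[of W] cW overlap A0 by simp
  qed
  with U show ?thesis by (intro that) (auto simp: C_def)
qed

text \<open>A set with fewer than a quarter of the vertices is compared with the union of its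
  translates, whose isoperimetric ratio is at most twice as large. This is the 2 in
  \<open>c / 2\<close>.\<close>

lemma expansion_from_large_sets:
  assumes "vertex_transitive G"
    and large: "\<And>U. U \<subseteq> pverts G \<Longrightarrow> card (pverts G) \<le> 4 * card U \<Longrightarrow>
      2 * card U \<le> card (pverts G) \<Longrightarrow> c * real (card U) \<le> real (card (vertex_boundary G U))"
    and A: "A \<subseteq> pverts G" "A \<noteq> {}" "2 * card A \<le> card (pverts G)"
    and "c \<ge> 0"
  shows "c / 2 * real (card A) \<le> real (card (vertex_boundary G A))"
proof (cases "card (pverts G) \<le> 4 * card A")
  case True
  have "c / 2 * real (card A) \<le> c * real (card A)" using \<open>c \<ge> 0\<close> by simp
  with large[OF A(1) True A(3)] show ?thesis by linarith
next
  case False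
  then obtain U where U: "U \<subseteq> pverts G" "card (pverts G) \<le> 4 * card U"
      "2 * card U \<le> card (pverts G)"
      "card (vertex_boundary G U) * card A \<le> 2 * card U * card (vertex_boundary G A)"
    using union_of_translates[OF assms(1) A(1,2)] by (metis nle_le)
  have "card U > 0" using U(2) False by linarith
  have "card U * (c * card A) = (c * card U) * card A" by simp
  also have "\<dots> \<le> real (card (vertex_boundary G U)) * card A"
    using large[OF U(1-3)] by (intro mult_right_mono) auto
  also have "\<dots> \<le> real (2 * card U * card (vertex_boundary G A))"
    unfolding of_nat_mult[symmetric] of_nat_le_iff by (rule U(4))
  also have "\<dots> = card U * (2 * card (vertex_boundary G A))" by simp
  finally show ?thesis using \<open>card U > 0\<close> by simp
qed

end

section \<open>Square-summable functions assembled piece by piece\<close>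

section \<open>Operators on the disjoint union\<close>

lemma sum_piece: "(\<Sum>p\<in>piece S n. f p) = (\<Sum>x\<in>S n. f (n, x))"
proof -
  have "piece S n = Pair n ` S n" by (auto simp: piece_def)
  then show ?thesis by (simp add: sum.reindex inj_on_def)
qed

lemma in_disjoint_union_iff: "(n, x) \<in> disjoint_union S \<longleftrightarrow> x \<in> S n"
  by (auto simp: disjoint_union_def piece_def)

text \<open>A finite partial sum is enlarged to all the pieces it meets, where the bound for each
  piece applies. This yields square-summability and the norm bound for functions defined
  piecewise.\<close>

lemma blockwise_sum_le:
  fixes f :: "(nat \<times> 'a) ell2" and h :: "nat \<times> 'a \<Rightarrow> complex"
  assumes fin: "\<And>n. finite (S n)" and off: "\<And>p. p \<notin> disjoint_union S \<Longrightarrow> h p = 0"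
    and le: "\<And>n. (\<Sum>x\<in>S n. (cmod (h (n, x)))\<^sup>2) \<le> C * (\<Sum>x\<in>S n. (cmod (ell2_apply f (n, x)))\<^sup>2)"
    and "C \<ge> 0"
  shows "(\<lambda>p. (cmod (h p))\<^sup>2) summable_on UNIV"
    and "(\<Sum>\<^sub>\<infinity>p. (cmod (h p))\<^sup>2) \<le> C * (norm f)\<^sup>2"
proof -
  have partial: "(\<Sum>p\<in>F. (cmod (h p))\<^sup>2) \<le> C * (norm f)\<^sup>2" if "finite F" for F
  proof -
    define N where "N = fst ` F"
    have N: "finite N" using that by (simp add: N_def)
    have fin': "finite (Sigma N S)" using N fin by auto
    have "(\<Sum>p\<in>F. (cmod (h p))\<^sup>2) \<le> (\<Sum>p\<in>F \<union> Sigma N S. (cmod (h p))\<^sup>2)"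
      using that fin' by (intro sum_mono2) auto
    also have "\<dots> = (\<Sum>p\<in>Sigma N S. (cmod (h p))\<^sup>2)"
    proof (rule sum.mono_neutral_right)
      show "\<forall>p\<in>F \<union> Sigma N S - Sigma N S. (cmod (h p))\<^sup>2 = 0"
      proof
        fix p assume p: "p \<in> F \<union> Sigma N S - Sigma N S"
        then have "p \<notin> disjoint_union S"
          by (cases p) (force simp: in_disjoint_union_iff N_def)
        then show "(cmod (h p))\<^sup>2 = 0" by (simp add: off)
      qed
    qed (use that fin' in auto)
    also have "\<dots> = (\<Sum>n\<in>N. \<Sum>x\<in>S n. (cmod (h (n, x)))\<^sup>2)"
      using N fin by (subst sum.Sigma) auto
    also have "\<dots> \<le> (\<Sum>n\<in>N. C * (\<Sum>x\<in>S n. (cmod (ell2_apply f (n, x)))\<^sup>2))"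
      by (intro sum_mono le)
    also have "\<dots> = C * (\<Sum>p\<in>Sigma N S. (cmod (ell2_apply f p))\<^sup>2)"
      using N fin by (subst sum_distrib_left[symmetric], subst sum.Sigma) auto
    also have "\<dots> \<le> C * (\<Sum>\<^sub>\<infinity>p. (cmod (ell2_apply f p))\<^sup>2)"
      using fin' \<open>C \<ge> 0\<close> by (intro mult_left_mono finite_sum_le_infsum ell2_summable) auto
    also have "(\<Sum>\<^sub>\<infinity>p. (cmod (ell2_apply f p))\<^sup>2) = (norm f)\<^sup>2"
      by (simp add: norm_ell2_def infsum_nonneg)
    finally show ?thesis .
  qed
  show summable: "(\<lambda>p. (cmod (h p))\<^sup>2) summable_on UNIV"
    by (rule nonneg_bdd_above_summable_on) (auto intro!: bdd_aboveI2 partial)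
  show "(\<Sum>\<^sub>\<infinity>p. (cmod (h p))\<^sup>2) \<le> C * (norm f)\<^sup>2"
    by (intro infsum_le_finite_sums summable partial)
qed

lemma norm_blockwise_le:
  fixes f g :: "(nat \<times> 'a) ell2"
  assumes "\<And>n. finite (S n)" "g \<in> ell2_on (disjoint_union S)"
    and "\<And>n. (\<Sum>x\<in>S n. (cmod (ell2_apply g (n, x)))\<^sup>2) \<le>
      C\<^sup>2 * (\<Sum>x\<in>S n. (cmod (ell2_apply f (n, x)))\<^sup>2)"
    and "C \<ge> 0"
  shows "norm g \<le> C * norm f"
proof -
  have "(norm g)\<^sup>2 = (\<Sum>\<^sub>\<infinity>p. (cmod (ell2_apply g p))\<^sup>2)"
    by (simp add: norm_ell2_def infsum_nonneg)
  also have "\<dots> \<le> C\<^sup>2 * (norm f)\<^sup>2"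
    by (rule blockwise_sum_le(2)[where S = S]) (use assms in \<open>auto simp: ell2_on_def\<close>)
  finally show ?thesis
    using \<open>C \<ge> 0\<close> by (metis power_mult_distrib power2_le_imp_le mult_nonneg_nonneg norm_ge_zero)
qed

lemma averaging_projection_piece:
  assumes "\<And>n. finite (S n)"
  shows "ell2_apply (averaging_projection (piece S) f) (n, x) =
    (if x \<in> S n then (\<Sum>y\<in>S n. ell2_apply f (n, y)) / of_nat (card (S n)) else 0)"
proof -
  have disj: "disjoint_family (piece S)" by (auto simp: disjoint_family_on_def piece_def)
  have fin: "finite (piece S n)" for n using assms by (simp add: piece_def)
  have in_piece: "(n, x) \<in> piece S n \<longleftrightarrow> x \<in> S n" by (simp add: piece_def)
  have card: "card (piece S n) = card (S n)" by (simp add: piece_def card_cartesian_product_singleton)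
  show ?thesis
    using averaging_projection_apply(1)[OF disj fin, of "(n, x)" n f]
      averaging_projection_apply(2)[OF disj fin, of "(n, x)" f] card
    by (cases "x \<in> S n") (simp_all add: sum_piece in_piece in_disjoint_union_iff flip: disjoint_union_def)
qed

lemma smoothing_add: "smoothing E D (\<lambda>y. f y + g y) x = smoothing E D f x + smoothing E D g x"
proof -
  have "(\<Sum>y\<in>E `` {x}. f x + g x - (f y + g y)) =
      (\<Sum>y\<in>E `` {x}. f x - f y) + (\<Sum>y\<in>E `` {x}. g x - g y)"
    unfolding sum.distrib[symmetric] by (intro sum.cong) auto
  then show ?thesis by (simp add: smoothing_def add_divide_distrib)
qed

lemma smoothing_scale: "smoothing E D (\<lambda>y. c * f y) x = c * smoothing E D f x"
proof -
  have "(\<Sum>y\<in>E `` {x}. c * f x - c * f y) = c * (\<Sum>y\<in>E `` {x}. f x - f y)"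
    unfolding sum_distrib_left by (intro sum.cong) (auto simp: right_diff_distrib)
  then show ?thesis by (simp add: smoothing_def right_diff_distrib)
qed

section \<open>Approximating the averaging projection by powers of the Markov operator\<close>

locale bounded_degree_graphs =
  fixes G :: "nat \<Rightarrow> 'a pair_pre_digraph" and D :: nat
  assumes graphs: "\<And>n. pair_graph (G n)" and D_pos: "D > 0"
    and degrees: "\<And>n v. v \<in> pverts (G n) \<Longrightarrow> out_degree (with_proj (G n)) v \<le> D"
begin

abbreviation "V n \<equiv> pverts (G n)"
abbreviation "E n \<equiv> parcs (G n)"
abbreviation "X \<equiv> disjoint_union (\<lambda>n. pverts (G n))"
abbreviation "P \<equiv> averaging_projection (piece (\<lambda>n. pverts (G n)))"

lemma bounded_degree_relation_graph: "bounded_degree_relation (V n) (E n) D"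
proof
  interpret pair_graph "G n" by (rule graphs)
  show "finite (V n)" by (rule pair_finite_verts)
  show "E n \<subseteq> V n \<times> V n" using in_arcsD1 in_arcsD2 by auto
  show "sym (E n)" using pair_sym_arcs by (simp add: symmetric_def)
  fix v assume "v \<in> V n"
  have "out_arcs (with_proj (G n)) v = Pair v ` (E n `` {v})" by (auto simp: out_arcs_def)
  then have "card (E n `` {v}) = out_degree (with_proj (G n)) v"
    by (simp add: out_degree_def card_image inj_on_def)
  with degrees[OF \<open>v \<in> V n\<close>] show "card (E n `` {v}) \<le> D" by simp
qed

sublocale rel: bounded_degree_relation "V n" "E n" D for n
  by (rule bounded_degree_relation_graph)

definition markov_function :: "(nat \<times> 'a) ell2 \<Rightarrow> nat \<times> 'a \<Rightarrow> complex" where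
  "markov_function f = (\<lambda>(n, x). if x \<in> V n then smoothing (E n) D (\<lambda>y. ell2_apply f (n, y)) x else 0)"

lemma markov_function_blockwise:
  "(\<Sum>x\<in>V n. (cmod (markov_function f (n, x)))\<^sup>2) \<le> 1 * (\<Sum>x\<in>V n. (cmod (ell2_apply f (n, x)))\<^sup>2)"
  using rel.smoothing_le[OF D_pos, of n "\<lambda>y. ell2_apply f (n, y)"] by (simp add: markov_function_def)

lemma markov_function_off: "p \<notin> X \<Longrightarrow> markov_function f p = 0"
  by (cases p) (simp add: markov_function_def in_disjoint_union_iff)

definition markov :: "(nat \<times> 'a) ell2 \<Rightarrow>\<^sub>L (nat \<times> 'a) ell2" where
  "markov = Blinfun (\<lambda>f. Abs_ell2 (markov_function f))"

text \<open>The contraction estimate on each piece gives square-summable values and operator norm at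
  most 1, which justifies both \<open>Abs_ell2\<close> and \<open>Blinfun\<close> in the
  definition.\<close>

lemma markov_apply: "ell2_apply (markov f) = markov_function f"
proof -
  have Abs: "ell2_apply (Abs_ell2 (markov_function f)) = markov_function f" for f
    using blockwise_sum_le(1)[OF rel.finite_V markov_function_off markov_function_blockwise]
    by (subst Abs_ell2_inverse) auto
  have "bounded_linear (\<lambda>f. Abs_ell2 (markov_function f))"
  proof (rule bounded_linear_intro[where K = 1])
    show "Abs_ell2 (markov_function (f + g)) =
        Abs_ell2 (markov_function f) + Abs_ell2 (markov_function g)" for f g
      by (intro ell2_eqI)
        (simp add: Abs, simp add: markov_function_def smoothing_add split: prod.splits)
    show "Abs_ell2 (markov_function (r *\<^sub>R f)) = r *\<^sub>R Abs_ell2 (markov_function f)" for r f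
      by (intro ell2_eqI)
        (simp add: Abs, simp add: markov_function_def smoothing_scale split: prod.splits)
    show "norm (Abs_ell2 (markov_function f)) \<le> norm f * 1" for f
      using norm_blockwise_le[of V "Abs_ell2 (markov_function f)" 1 f] rel.finite_V
        markov_function_blockwise[of f] markov_function_off
      by (simp add: Abs ell2_on_def)
  qed
  then show ?thesis by (simp add: markov_def bounded_linear_Blinfun_apply Abs)
qed

lemma markov_in_ell2_on: "markov f \<in> ell2_on X"
  by (simp add: ell2_on_def markov_apply markov_function_off)

lemma markov_scaleC: "markov (c *\<^sub>C f) = c *\<^sub>C markov f"
  by (intro ell2_eqI)
    (simp add: markov_apply, simp add: markov_function_def smoothing_scale split: prod.splits)

lemma markov_restrict: "markov (ell2_restrict X f) = markov f"
proof (intro ell2_eqI)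
  fix p :: "nat \<times> 'a"
  obtain n x where p: "p = (n, x)" by fastforce
  show "ell2_apply (markov (ell2_restrict X f)) p = ell2_apply (markov f) p"
    using rel.neighbours_subset[of n x]
    by (auto simp: p markov_apply markov_function_def smoothing_def ell2_restrict.rep_eq
      in_disjoint_union_iff intro!: sum.cong)
qed

lemma sum_markov: "(\<Sum>x\<in>V n. ell2_apply (markov f) (n, x)) = (\<Sum>x\<in>V n. ell2_apply f (n, x))"
  using rel.sum_smoothing[of n "\<lambda>y. ell2_apply f (n, y)"]
  by (simp add: markov_apply markov_function_def)

lemma averaging_projection_P:
  "ell2_apply (P f) (n, x) =
    (if x \<in> V n then (\<Sum>y\<in>V n. ell2_apply f (n, y)) / of_nat (card (V n)) else 0)"
  by (rule averaging_projection_piece[OF rel.finite_V])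

lemma averaging_projection_in_ell2_on: "P f \<in> ell2_on X"
  by (auto simp: ell2_on_def averaging_projection_P in_disjoint_union_iff)

lemma sum_averaging_projection:
  "(\<Sum>x\<in>V n. ell2_apply (P f) (n, x)) = (\<Sum>x\<in>V n. ell2_apply f (n, x))"
proof (cases "V n = {}")
  case False
  then have "card (V n) \<noteq> 0" using rel.finite_V by simp
  then show ?thesis by (simp add: averaging_projection_P)
qed simp

text \<open>\<open>P f\<close> is constant along every arc. Because of this fixed-point property,
  one more factor \<open>markov\<close> acts directly on the error of the approximation.\<close>

lemma markov_averaging_projection: "markov (P f) = P f"
proof (intro ell2_eqI)
  fix p :: "nat \<times> 'a"
  obtain n x where p: "p = (n, x)" by fastforce
  have "(\<Sum>y\<in>E n `` {x}. ell2_apply (P f) (n, x) - ell2_apply (P f) (n, y)) = 0" if "x \<in> V n"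
    using that rel.neighbours_subset[of n x]
    by (intro sum.neutral ballI) (auto simp: averaging_projection_P)
  then show "ell2_apply (markov (P f)) p = ell2_apply (P f) p"
    by (auto simp: p markov_apply markov_function_def smoothing_def averaging_projection_P)
qed

text \<open>The recursion starts at \<open>markov\<close>, not at the identity, which need not
  vanish off \<open>X\<close> and so need not lie in \<open>operators_on X\<close>. Index
  \<open>k\<close> thus stands for \<open>k + 1\<close> factors.\<close>

primrec markov_power :: "nat \<Rightarrow> (nat \<times> 'a) ell2 \<Rightarrow>\<^sub>L (nat \<times> 'a) ell2" where
  "markov_power 0 = markov"
| "markov_power (Suc k) = markov o\<^sub>L markov_power k"

lemma markov_power_in_operators_on: "markov_power k \<in> operators_on X"
  by (induction k)
    (auto simp: operators_on_def markov_in_ell2_on markov_scaleC markov_restrict)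

lemma markov_nonzeroD:
  assumes "ell2_apply (markov f) (n, x) \<noteq> 0"
  obtains y where "y = x \<or> (x, y) \<in> E n" "ell2_apply f (n, y) \<noteq> 0"
proof (rule ccontr)
  assume "\<not> thesis"
  then have "ell2_apply f (n, x) = 0" "\<And>y. (x, y) \<in> E n \<Longrightarrow> ell2_apply f (n, y) = 0"
    using that by blast+
  then have "ell2_apply (markov f) (n, x) = 0"
    by (simp add: markov_apply markov_function_def smoothing_def sum.neutral)
  with assms show False by contradiction
qed

text \<open>Each factor moves the support by at most one edge and never between pieces; index
  \<open>k\<close> has \<open>Suc k\<close> factors.\<close>

lemma markov_power_support:
  assumes "matrix_entry (markov_power k) (n, x) (m, y) \<noteq> 0"
  shows "m = n \<and> (\<exists>j \<le> Suc k. (x, y) \<in> E n ^^ j)"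
  using assms
proof (induction k arbitrary: x)
  case 0
  then obtain z where "z = x \<or> (x, z) \<in> E n" "ell2_apply (ket (m, y)) (n, z) \<noteq> 0"
    by (auto simp: matrix_entry_def elim: markov_nonzeroD)
  then have "m = n" "x = y \<or> (x, y) \<in> E n" by (auto simp: ket.rep_eq split: if_splits)
  then show ?case by (metis le_SucI order_refl relpow_0_I relpow_1 One_nat_def zero_le)
next
  case (Suc k)
  then obtain z where z: "z = x \<or> (x, z) \<in> E n"
      and "matrix_entry (markov_power k) (n, z) (m, y) \<noteq> 0"
    by (auto simp: matrix_entry_def elim: markov_nonzeroD)
  then obtain j where "m = n" "j \<le> Suc k" "(z, y) \<in> E n ^^ j"
    using Suc.IH by blast
  with z show ?case by (metis le_SucI Suc_le_mono relpow_Suc_I2)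
qed

lemma markov_power_finite_propagation:
  assumes "coarse_disjoint_union_metric V (\<lambda>n. path_dist (G n)) d"
  shows "finite_propagation X d (markov_power k)"
  unfolding finite_propagation_def
proof (intro exI[of _ "real (Suc k)"] conjI ballI impI)
  fix p q assume "p \<in> X" "q \<in> X" and far: "d p q > real (Suc k)"
  obtain n x m y where p: "p = (n, x)" and q: "q = (m, y)" by fastforce
  show "matrix_entry (markov_power k) p q = 0"
  proof (rule ccontr)
    assume "matrix_entry (markov_power k) p q \<noteq> 0"
    then obtain j where j: "m = n" "j \<le> Suc k" "(x, y) \<in> E n ^^ j"
      using markov_power_support unfolding p q by blast
    have "d p q = path_dist (G n) x y"
      using assms \<open>p \<in> X\<close> \<open>q \<in> X\<close> j(1)
      by (auto simp: coarse_disjoint_union_metric_def p q in_disjoint_union_iff)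
    also have "\<dots> \<le> real j" unfolding path_dist_def using j(3) by (simp add: Least_le)
    finally show False using far j(2) by simp
  qed
qed simp

lemma averaging_projection_in_roe_algebra:
  assumes "c > 0"
    and exp: "\<And>n A. A \<subseteq> V n \<Longrightarrow> 2 * card A \<le> card (V n) \<Longrightarrow>
      c * real (card A) \<le> real (card (E n \<inter> A \<times> (- A)))"
    and "coarse_disjoint_union_metric V (\<lambda>n. path_dist (G n)) d"
  shows "P \<in> uniform_roe_algebra X d"
proof -
  \<comment> \<open>Capping the constant at 1 keeps the expression under the root in
    \<open>q\<close> nonnegative.\<close>
  define b where "b = min c 1"
  have b: "b > 0" "b \<le> 1" using \<open>c > 0\<close> by (auto simp: b_def)
  have exp_b: "b * real (card A) \<le> real (card (E n \<inter> A \<times> (- A)))"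
    if "A \<subseteq> V n" "2 * card A \<le> card (V n)" for n A
  proof -
    have "b * real (card A) \<le> c * real (card A)" by (intro mult_right_mono) (auto simp: b_def)
    with exp[OF that] show ?thesis by linarith
  qed
  define q where "q = sqrt (1 - b\<^sup>2 / (16 * (real D)\<^sup>2))"
  have "b\<^sup>2 \<le> 1" using b by (simp add: power_le_one)
  moreover have "(real D)\<^sup>2 \<ge> 1" using D_pos by (simp add: one_le_power)
  ultimately have "b\<^sup>2 \<le> 16 * (real D)\<^sup>2" by linarith
  then have "b\<^sup>2 / (16 * (real D)\<^sup>2) \<le> 1" using D_pos by (simp add: divide_le_eq_1)
  then have q2: "q\<^sup>2 = 1 - b\<^sup>2 / (16 * (real D)\<^sup>2)" and q: "q \<ge> 0" by (simp_all add: q_def)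
  have "b\<^sup>2 / (16 * (real D)\<^sup>2) > 0" using b D_pos by simp
  then have "q < 1" unfolding q_def by simp
  have contraction: "norm (markov h) \<le> q * norm h"
    if "\<And>n. (\<Sum>x\<in>V n. ell2_apply h (n, x)) = 0" for h
  proof (rule norm_blockwise_le[OF rel.finite_V markov_in_ell2_on _ q])
    fix n
    show "(\<Sum>x\<in>V n. (cmod (ell2_apply (markov h) (n, x)))\<^sup>2) \<le>
        q\<^sup>2 * (\<Sum>x\<in>V n. (cmod (ell2_apply h (n, x)))\<^sup>2)"
      using rel.smoothing_contraction[OF D_pos less_imp_le[OF b(1)] exp_b that]
      by (simp add: q2 markov_apply markov_function_def)
  qed
  have sums: "(\<Sum>x\<in>V n. ell2_apply (markov_power k f) (n, x)) = (\<Sum>x\<in>V n. ell2_apply f (n, x))" for k n f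
    by (induction k) (simp_all add: sum_markov)
  have step: "norm (markov_power k f - P f) \<le> q ^ k * (norm (markov - P) * norm f)" for k f
  proof (induction k)
    case 0
    show ?case using norm_blinfun[of "markov - P" f] by (simp add: blinfun.diff_left)
  next
    case (Suc k)
    \<comment> \<open>Both \<open>markov_power k\<close> and \<open>P\<close> preserve the sum over
      each piece, so the error has mean zero there and the contraction applies.\<close>
    have "markov_power (Suc k) f - P f = markov (markov_power k f - P f)"
      by (simp add: blinfun.diff_right markov_averaging_projection)
    also have "norm \<dots> \<le> q * norm (markov_power k f - P f)"
      by (rule contraction) (simp add: sum_subtractf sums sum_averaging_projection)
    also have "\<dots> \<le> q * (q ^ k * (norm (markov - P) * norm f))"
      using Suc q by (rule mult_left_mono)
    finally show ?case by (simp add: mult.assoc)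
  qed
  have bound: "norm (markov_power k - P) \<le> q ^ k * norm (markov - P)" for k
    by (rule norm_blinfun_bound) (use step q in \<open>auto simp: blinfun.diff_left mult.assoc\<close>)
  have "(\<lambda>k. q ^ k * norm (markov - P)) \<longlonglongrightarrow> 0 * norm (markov - P)"
    by (intro tendsto_mult_right LIMSEQ_power_zero) (use q \<open>q < 1\<close> in auto)
  then have "(\<lambda>k. q ^ k * norm (markov - P)) \<longlonglongrightarrow> 0" by simp
  then have "(\<lambda>k. markov_power k - P) \<longlonglongrightarrow> 0"
    by (rule Lim_null_comparison[OF always_eventually, rotated]) (simp add: bound)
  then have "markov_power \<longlonglongrightarrow> P" by (rule LIM_zero_cancel)
  then show ?thesis
    unfolding uniform_roe_algebra_def closure_sequential
    using markov_power_in_operators_on markov_power_finite_propagation[OF assms(3)] by blast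
qed

section \<open>Expansion from approximation by finite propagation operators\<close>

lemma norm_sum_ket:
  assumes "finite A"
  shows "norm (\<Sum>p\<in>A. ket p) = sqrt (card A)"
proof -
  have "cinner (\<Sum>p\<in>A. ket p) (\<Sum>p\<in>A. ket p) = of_nat (card A)"
    using assms by (subst cinner_finite_support[OF assms])
      (simp_all add: ell2_on_def ell2_apply_sum_ket)
  then show ?thesis by (simp add: norm_eq_sqrt_inner inner_ell2_def)
qed

text \<open>Test \<open>P - T\<close> on the indicators of \<open>A\<close> and \<open>B\<close>.
  The coefficient of \<open>T\<close> vanishes, that of \<open>P\<close> is |A| |B| / |V|, and
  Cauchy-Schwarz bounds the difference.\<close>

lemma separated_sets_card_le:
  assumes "T \<in> operators_on X" "A \<subseteq> V n" "B \<subseteq> V n"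
    and zero: "\<And>x y. x \<in> A \<Longrightarrow> y \<in> B \<Longrightarrow> matrix_entry T (n, x) (n, y) = 0"
  shows "real (card A) * real (card B) \<le>
    norm (T - P) * real (card (V n)) * (sqrt (card A) * sqrt (card B))"
proof -
  have fin: "finite A" "finite B" using assms(2,3) rel.finite_V finite_subset by blast+
  define a b where "a = (\<Sum>p\<in>Pair n ` A. ket p)" and "b = (\<Sum>p\<in>Pair n ` B. ket p)"
  have a: "ell2_apply a (n, x) = (if x \<in> A then 1 else 0)"
    and b: "ell2_apply b (n, x) = (if x \<in> B then 1 else 0)" for x
    unfolding a_def b_def using fin by (auto simp: ell2_apply_sum_ket)
  have na: "norm a = sqrt (card A)" and nb: "norm b = sqrt (card B)"
    unfolding a_def b_def using fin by (simp_all add: norm_sum_ket card_image inj_on_def)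
  have ca: "cinner a g = (\<Sum>x\<in>A. ell2_apply g (n, x))" for g
  proof -
    have "cinner a g = (\<Sum>p\<in>Pair n ` A. cnj (ell2_apply a p) * ell2_apply g p)"
      using fin by (intro cinner_finite_support) (auto simp: ell2_on_def a_def ell2_apply_sum_ket)
    also have "\<dots> = (\<Sum>x\<in>A. ell2_apply g (n, x))"
      by (simp add: sum.reindex inj_on_def a)
    finally show ?thesis .
  qed
  have T: "ell2_apply (T b) (n, x) = 0" if "x \<in> A" for x
  proof -
    have app: "ell2_apply (\<Sum>p\<in>F. g p) z = (\<Sum>p\<in>F. ell2_apply (g p) z)"
      for F z and g :: "nat \<times> 'a \<Rightarrow> (nat \<times> 'a) ell2"
      by (induction F rule: infinite_finite_induct) auto
    have "ell2_apply (T b) (n, x) = (\<Sum>y\<in>B. matrix_entry T (n, x) (n, y))"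
      unfolding b_def blinfun.sum_right app matrix_entry_def by (simp add: sum.reindex inj_on_def)
    then show ?thesis using zero that by simp
  qed
  have sb: "(\<Sum>y\<in>V n. ell2_apply b (n, y)) = of_nat (card B)"
    using assms(3) rel.finite_V[of n] by (simp add: b sum.If_cases Int_absorb1)
  have "cinner a (P b - T b) = (\<Sum>x\<in>A. of_nat (card B) / of_nat (card (V n)))"
    unfolding ca using assms(2) by (intro sum.cong) (auto simp: T averaging_projection_P sb)
  then have "inner a (P b - T b) = real (card A) * real (card B) / real (card (V n))"
    by (simp add: inner_ell2_def Re_divide_of_nat)
  then have "real (card A) * real (card B) / real (card (V n)) \<le> norm a * norm (P b - T b)"
    using norm_cauchy_schwarz[of a "P b - T b"] by simp
  also have "norm a * norm (P b - T b) \<le> norm a * (norm (T - P) * norm b)"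
    using norm_blinfun[of "T - P" b]
    by (intro mult_left_mono) (simp_all add: blinfun.diff_left norm_minus_commute)
  finally have bound: "real (card A) * real (card B) / real (card (V n)) \<le>
      norm (T - P) * (sqrt (card A) * sqrt (card B))"
    by (simp add: na nb mult_ac)
  then show ?thesis
  proof (cases "V n = {}")
    case False
    then have "real (card (V n)) > 0" using rel.finite_V by (simp add: card_gt_0_iff)
    then show ?thesis
      using bound by (simp add: divide_le_eq mult_ac)
  qed (use assms(2) in simp)
qed

text \<open>With n vertices, the \<open>r\<close>-neighbourhood of \<open>U\<close> misses at most
  n/4 of them while \<open>U\<close> has at most n/2, so at least n/4, hence at least |U|/2, new
  vertices appear. All lie within \<open>r\<close> steps of the boundary, whose neighbourhood is at
  most \<open>(D + 1) ^ r\<close> times as large.\<close>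

lemma large_sets_expand:
  assumes conn: "\<And>n. graph_connected (G n)"
    and d: "coarse_disjoint_union_metric V (\<lambda>n. path_dist (G n)) d"
    and roe: "P \<in> uniform_roe_algebra X d"
  obtains c where "c > 0" "\<And>n U. U \<subseteq> V n \<Longrightarrow> card (V n) \<le> 4 * card U \<Longrightarrow>
    2 * card U \<le> card (V n) \<Longrightarrow> c * real (card U) \<le> real (card (vertex_boundary (G n) U))"
proof -
  \<comment> \<open>The tolerance 1/4 leads to |U| |B| at most n^2/16 below, and |U| is at least
    n/4, leaving |B| at most n/4.\<close>
  obtain T where T: "T \<in> operators_on X" "finite_propagation X d T" "norm (T - P) < 1/4"
    using roe unfolding uniform_roe_algebra_def closure_approachable dist_norm
    by (metis (no_types, lifting) mem_Collect_eq zero_less_divide_1_iff zero_less_numeral)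
  then obtain R where R: "\<And>p q. p \<in> X \<Longrightarrow> q \<in> X \<Longrightarrow> d p q > R \<Longrightarrow> matrix_entry T p q = 0"
    unfolding finite_propagation_def by blast
  define r where "r = nat \<lceil>R\<rceil>"
  have r: "R \<le> real r" unfolding r_def by linarith
  show ?thesis
  proof (rule that[of "1 / (2 * real ((D + 1) ^ r))"])
    fix n U assume U: "U \<subseteq> V n" "card (V n) \<le> 4 * card U" "2 * card U \<le> card (V n)"
    let ?N = "neighbourhood (E n) r U"
    define B where "B = V n - ?N"
    have "matrix_entry T (n, x) (n, y) = 0" if "x \<in> U" "y \<in> B" for x y
    proof -
      interpret pair_graph "G n" by (rule graphs)
      have xy: "x \<in> V n" "y \<in> V n" using that U by (auto simp: B_def)
      \<comment> \<open>Connectedness makes the \<open>LEAST\<close> in \<open>path_dist\<close> the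
        length of an actual walk.\<close>
      have "\<exists>k. (x, y) \<in> E n ^^ k"
      proof -
        have "strongly_connected (with_proj (G n))"
          using symmetric_connected_imp_strongly_connected[OF pair_sym_arcs conn] .
        then have "x \<rightarrow>\<^sup>*\<^bsub>with_proj (G n)\<^esub> y" using xy by auto
        then have "(x, y) \<in> (E n)\<^sup>*" by (auto simp: Digraph.reachable_def dest: rtrancl_on_rtranclI)
        then show ?thesis by (simp add: rtrancl_power)
      qed
      then have "(x, y) \<in> E n ^^ (LEAST k. (x, y) \<in> E n ^^ k)" by (rule LeastI_ex)
      then have "(LEAST k. (x, y) \<in> E n ^^ k) > r"
        using relpow_in_neighbourhood[where E = "E n" and U = U and r = r] that by (force simp: B_def not_less)
      then have "path_dist (G n) x y > R" using r by (simp add: path_dist_def)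
      then have "d (n, x) (n, y) > R"
        using d xy by (simp add: coarse_disjoint_union_metric_def)
      then show ?thesis using R xy by (simp add: in_disjoint_union_iff)
    qed
    then have key: "real (card U) * real (card B) \<le>
        norm (T - P) * real (card (V n)) * (sqrt (card U) * sqrt (card B))"
      using U by (intro separated_sets_card_le[OF T(1)]) (auto simp: B_def)
    have cB: "4 * card B \<le> card (V n)"
    proof (cases "card U = 0 \<or> card B = 0")
      case False
      define s t where "s = sqrt (card U)" and "t = sqrt (card B)"
      have st: "s > 0" "t > 0" "s\<^sup>2 = card U" "t\<^sup>2 = card B" using False by (simp_all add: s_def t_def)
      have "s * t * (s * t) \<le> norm (T - P) * real (card (V n)) * (s * t)"
        using key by (simp add: s_def t_def algebra_simps power2_eq_square)
      then have "s * t \<le> norm (T - P) * real (card (V n))" using st by simp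
      also have "\<dots> \<le> 1/4 * real (card (V n))" using T(3) by (intro mult_right_mono) auto
      finally have "(s * t)\<^sup>2 \<le> (1/4 * real (card (V n)))\<^sup>2" using st by (intro power_mono) auto
      then have *: "16 * (card U * real (card B)) \<le> (card (V n))\<^sup>2"
        by (simp add: power_mult_distrib st power_divide)
      have "real (card (V n)) * (4 * card B) \<le> real (4 * card U) * (4 * card B)"
        using U(2) by (intro mult_right_mono) auto
      also have "\<dots> \<le> real (card (V n)) * real (card (V n))" using * by (simp add: power2_eq_square)
      finally show ?thesis using U(3) False by (simp add: mult_le_cancel_left)
    next
      case True
      moreover have "card B \<le> card (V n)" using rel.finite_V by (intro card_mono) (auto simp: B_def)
      ultimately show ?thesis using U(2) by auto
    qed
    have bd: "vertex_boundary (G n) U \<subseteq> V n" by (auto simp: vertex_boundary_def)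
    have "card ?N \<le> card (U \<union> neighbourhood (E n) r (vertex_boundary (G n) U))"
      using neighbourhood_subset_boundary[OF rel.E_subset[of n], of r U]
        rel.card_neighbourhood_le[OF bd, of r] U(1) rel.finite_V[of n]
      by (intro card_mono) (auto simp: vertex_boundary_def intro: finite_subset)
    also have "\<dots> \<le> card U + (D + 1) ^ r * card (vertex_boundary (G n) U)"
      using rel.card_neighbourhood_le[OF bd, of r]
        card_Un_le[of U "neighbourhood (E n) r (vertex_boundary (G n) U)"] by linarith
    finally have "card ?N \<le> card U + (D + 1) ^ r * card (vertex_boundary (G n) U)" .
    moreover have "card ?N + card B = card (V n)"
    proof -
      have sub: "?N \<subseteq> V n" using rel.card_neighbourhood_le[OF U(1), of r] by blast
      then have "finite ?N" using rel.finite_V finite_subset by blast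
      then show ?thesis
        using card_Diff_subset[OF _ sub] card_mono[OF rel.finite_V sub] by (simp add: B_def)
    qed
    ultimately have "card U \<le> 2 * ((D + 1) ^ r * card (vertex_boundary (G n) U))"
      using cB U(3) by linarith
    then have "real (card U) \<le> real (2 * ((D + 1) ^ r * card (vertex_boundary (G n) U)))"
      by (simp only: of_nat_le_iff)
    then have "real (card U) \<le> 2 * (real ((D + 1) ^ r) * real (card (vertex_boundary (G n) U)))"
      by (simp only: of_nat_mult of_nat_numeral)
    moreover have "1 / (2 * a) * u \<le> b" if "a > 0" "u \<le> 2 * (a * b)" for a b u :: real
      using that by (simp add: field_simps)
    moreover have "real ((D + 1) ^ r) > 0" by simp
    ultimately show
      "1 / (2 * real ((D + 1) ^ r)) * real (card U) \<le> real (card (vertex_boundary (G n) U))"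
      by blast
  qed simp
qed

text \<open>Every boundary vertex is the head of an arc leaving \<open>A\<close>. This passes from
  the vertex expansion in the definition of expanders to the edge expansion used for Cheeger's
  inequality.\<close>

lemma card_vertex_boundary_le: "card (vertex_boundary (G n) A) \<le> card (E n \<inter> A \<times> (- A))"
proof -
  have "vertex_boundary (G n) A \<subseteq> snd ` (E n \<inter> A \<times> (- A))"
    by (force simp: vertex_boundary_def image_iff)
  then have "card (vertex_boundary (G n) A) \<le> card (snd ` (E n \<inter> A \<times> (- A)))"
    using rel.finite_E by (intro card_mono) auto
  also have "\<dots> \<le> card (E n \<inter> A \<times> (- A))" using rel.finite_E by (intro card_image_le) auto
  finally show ?thesis .
qed

end

section \<open>The two implications combined\<close>

theorem corollaryG:
  fixes G :: "nat \<Rightarrow> 'a pair_pre_digraph"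
    and d :: "nat \<times> 'a \<Rightarrow> nat \<times> 'a \<Rightarrow> real"
  assumes "\<And>n. pair_graph (G n)"
    and "\<And>n. graph_connected (G n)"
    and "\<And>n. vertex_transitive (G n)"
    and "uniformly_bounded_degree G"
    and "filterlim (\<lambda>n. card (pverts (G n))) at_top sequentially"
    and "coarse_disjoint_union_metric (\<lambda>n. pverts (G n)) (\<lambda>n. path_dist (G n)) d"
  shows "expander_sequence G \<longleftrightarrow>
    averaging_projection (piece (\<lambda>n. pverts (G n)))
      \<in> uniform_roe_algebra (disjoint_union (\<lambda>n. pverts (G n))) d"
proof -
  obtain D where D: "\<And>n v. v \<in> pverts (G n) \<Longrightarrow> out_degree (with_proj (G n)) v \<le> D"
    using assms(4) unfolding uniformly_bounded_degree_def by blast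
  \<comment> \<open>The successor guarantees a positive degree bound, since smoothing divides by
    it.\<close>
  interpret bounded_degree_graphs G "Suc D"
    by (rule bounded_degree_graphs.intro) (use assms(1) D in \<open>auto intro: le_SucI\<close>)
  show ?thesis
  proof
    assume "expander_sequence G"
    then obtain c where "c > 0" and c: "\<And>n A. A \<subseteq> V n \<Longrightarrow> A \<noteq> {} \<Longrightarrow>
        real (card A) \<le> 1/2 * real (card (V n)) \<Longrightarrow>
        real (card (vertex_boundary (G n) A)) > c * real (card A)"
      unfolding expander_sequence_def by blast
    have "c * real (card A) \<le> real (card (E n \<inter> A \<times> (- A)))"
      if "A \<subseteq> V n" "2 * card A \<le> card (V n)" for n A
    proof (cases "A = {}")
      case False
      have "real (card A) \<le> 1/2 * real (card (V n))" using that(2) by linarith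
      with c[OF that(1) False] card_vertex_boundary_le[of n A] show ?thesis by linarith
    qed simp
    then show "P \<in> uniform_roe_algebra X d"
      by (rule averaging_projection_in_roe_algebra[OF \<open>c > 0\<close> _ assms(6)])
  next
    assume "P \<in> uniform_roe_algebra X d"
    from large_sets_expand[OF assms(2,6) this]
    obtain c where c: "c > 0" and large: "\<And>n U. U \<subseteq> V n \<Longrightarrow> card (V n) \<le> 4 * card U \<Longrightarrow>
        2 * card U \<le> card (V n) \<Longrightarrow> c * real (card U) \<le> real (card (vertex_boundary (G n) U))"
      by blast
    \<comment> \<open>One halving comes from the translates; the second turns the weak inequality
      into the strict one of the definition, as \<open>A\<close> is nonempty.\<close>
    have "c / 4 * real (card A) < real (card (vertex_boundary (G n) A))"
      if A: "A \<subseteq> V n" "A \<noteq> {}" "real (card A) \<le> 1/2 * real (card (V n))" for n A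
    proof -
      have "card A > 0" using A rel.finite_V finite_subset by (metis card_gt_0_iff)
      then have "c / 4 * real (card A) < c / 2 * real (card A)" using c by simp
      also have "2 * card A \<le> card (V n)" using A(3) by linarith
      then have "c / 2 * real (card A) \<le> real (card (vertex_boundary (G n) A))"
        using A(1,2) c by (intro pair_graph.expansion_from_large_sets[OF assms(1,3)] large) auto
      finally show ?thesis .
    qed
    moreover have "c / 4 > 0" using c by simp
    ultimately show "expander_sequence G"
      unfolding expander_sequence_def using assms(1,4,5) by blast
  qed
qed

end
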